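(* Let $K$ be an algebraically closed field of characteristic $0$, let $d$ and $n_1,\dots,n_d$ be positive integers, and let $X=X_{n_1,\dots,n_d}\subset \mathbb{P}^{N}$, $N=\prod_{i=1}^d (n_i+1)-1$, be the Segre variety, with tangent developable $\tau(X)$. For each $P\in\tau(X)$, the tensor rank of $P$ equals its type: $$r_{X}(P)=\eta_{X}(P).$$
   Context: Work over an algebraically closed field $K$ of characteristic $0$. For positive integers $d,n_1,\dots,n_d$ let $j=j_{n_1,\dots,n_d}:\mathbb{P}^{n_1}\times\cdots\times\mathbb{P}^{n_d}\to\mathbb{P}^{N}$, $N=\prod_{i=1}^d(n_i+1)-1$, be the Segre embedding, given by the sections of $\mathcal{O}(1,\dots,1)$, and let $X=X_{n_1,\dots,n_d}$ be its image. Equivalently, writing $\mathbb{P}^{n_i}=\mathbb{P}(V_i)$ with $\dim V_i=n_i+1$, $X\subset\mathbb{P}(V_1\otimes\cdots\otimes V_d)$ is the set of classes $[v_1\otimes\cdots\otimes v_d]$ with $0\neq v_i\in V_i$. The symbol $\langle\ \rangle$ denotes linear span in $\mathbb{P}^N$ (for a closed subscheme: the smallest linear subspace containing it). Rank: for $P\in\mathbb{P}^N$, $r_X(P)$ is the minimal cardinality of a finite set $S\subset X$ such that $P\in\langle S\rangle$. Tangent developable: $\tau(X)=\bigcup_{O\in X}T_OX$, where $T_OX\subset\mathbb{P}^N$ is the embedded projective tangent space to $X$ at $O$. Subspaces $Y_{O,i}$: for $O=j(O_1,\dots,O_d)\in X$ and $i\in\{1,\dots,d\}$, $$Y_{O,i}=j\big(\{O_1\}\times\cdots\times\{O_{i-1}\}\times\mathbb{P}^{n_i}\times\{O_{i+1}\}\times\cdots\times\{O_d\}\big),$$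 which is an $n_i$-dimensional linear subspace of $\mathbb{P}^N$. Type: let $J$ be the set of all pairs $(O,Z)$ with $O\in X$ and $Z\subset X$ a zero-dimensional subscheme with $Z_{red}=\{O\}$ and $\deg(Z)=2$ (so $\langle Z\rangle$ is a line contained in $T_OX$). For $P\in\tau(X)\setminus X$, the type of $P$ is $$\eta_X(P)=\min_{(O,Z)\in J}\{\sharp(E)\ :\ E\subseteq\{1,\dots,d\},\ P\in\langle Z\rangle\subseteq\langle\textstyle\bigcup_{i\in E}Y_{O,i}\rangle\}.$$ For $P\in X$ one sets $\eta_X(P)=1$. *)

theory Defs
  imports
    "HOL-Computational_Algebra.Computational_Algebra"
    "HOL-Algebra.Ideal"
    "HOL-Library.Poly_Mapping"
    "HOL-Library.Function_Algebras"
    "HOL-Library.FuncSet"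
begin

section \<open>Projective spaces in coordinates\<close>

text \<open>
  For a finite set \<open>I\<close> of coordinate labels, the vector space \<open>K\<^sup>I\<close> consists of the functions that vanish
  outside \<open>I\<close>. A point of the projective space \<open>\<P>(K\<^sup>I)\<close> is a one-dimensional subspace of \<open>K\<^sup>I\<close>, given
  as the set of its vectors.
\<close>

definition fun_scale :: "'a::field \<Rightarrow> ('i \<Rightarrow> 'a) \<Rightarrow> 'i \<Rightarrow> 'a" where
  "fun_scale c v = (\<lambda>i. c * v i)"

global_interpretation fun_vs: vector_space fun_scale
  by standard (auto simp: fun_scale_def fun_eq_iff algebra_simps)

definition coord_space :: "'i set \<Rightarrow> ('i \<Rightarrow> 'a::field) set" where
  "coord_space I = {v. \<forall>i. i \<notin> I \<longrightarrow> v i = 0}"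

definition proj :: "('i \<Rightarrow> 'a::field) set \<Rightarrow> ('i \<Rightarrow> 'a) set set" where
  "proj W = {fun_vs.span {v} | v. v \<in> W \<and> v \<noteq> 0}"

definition proj_space :: "'i set \<Rightarrow> ('i \<Rightarrow> 'a::field) set set" where
  "proj_space I = proj (coord_space I)"

definition linear_subspace :: "'i set \<Rightarrow> ('i \<Rightarrow> 'a::field) set set \<Rightarrow> bool" where
  "linear_subspace I L \<longleftrightarrow> (\<exists>W. fun_vs.subspace W \<and> W \<subseteq> coord_space I \<and> L = proj W)"

definition lin_span :: "('i \<Rightarrow> 'a::field) set set \<Rightarrow> ('i \<Rightarrow> 'a) set set" where
  "lin_span S = proj (fun_vs.span (\<Union>S))"


section \<open>Polynomials in the homogeneous coordinates\<close>

text \<open>A monomial is a finitely supported exponent vector.\<close>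

type_synonym ('i, 'a) mpoly = "('i \<Rightarrow>\<^sub>0 nat) \<Rightarrow>\<^sub>0 'a"

definition mpoly_scale :: "'a::field \<Rightarrow> ('i, 'a) mpoly \<Rightarrow> ('i, 'a) mpoly" where
  "mpoly_scale c p = Poly_Mapping.single 0 c * p"

global_interpretation mpoly_vs: vector_space mpoly_scale
  by standard
    (simp_all add: mpoly_scale_def algebra_simps single_add mult_single flip: mult.assoc)

definition mpoly_eval :: "('i \<Rightarrow> 'a::field) \<Rightarrow> ('i, 'a) mpoly \<Rightarrow> 'a" where
  "mpoly_eval v p =
     (\<Sum>m\<in>Poly_Mapping.keys p. Poly_Mapping.lookup p m *
        (\<Prod>i\<in>Poly_Mapping.keys m. v i ^ Poly_Mapping.lookup m i))"

definition mpoly_partial :: "'i \<Rightarrow> ('i, 'a::field) mpoly \<Rightarrow> ('i, 'a) mpoly" where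
  "mpoly_partial i p =
     (\<Sum>m\<in>Poly_Mapping.keys p.
        Poly_Mapping.single (m - Poly_Mapping.single i 1)
          (of_nat (Poly_Mapping.lookup m i) * Poly_Mapping.lookup p m))"

definition mono_deg :: "('i \<Rightarrow>\<^sub>0 nat) \<Rightarrow> nat" where
  "mono_deg m = (\<Sum>i\<in>Poly_Mapping.keys m. Poly_Mapping.lookup m i)"

definition hom_part :: "nat \<Rightarrow> ('i, 'a::field) mpoly \<Rightarrow> ('i, 'a) mpoly" where
  "hom_part t p =
     (\<Sum>m\<in>{m \<in> Poly_Mapping.keys p. mono_deg m = t}.
        Poly_Mapping.single m (Poly_Mapping.lookup p m))"

text \<open>The polynomial ring \<open>K[x\<^sub>i | i \<in> I]\<close>, and its homogeneous elements of degree \<open>t\<close> (including 0).\<close>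

definition polys :: "'i set \<Rightarrow> ('i, 'a::field) mpoly set" where
  "polys I = {p. \<forall>m\<in>Poly_Mapping.keys p. Poly_Mapping.keys m \<subseteq> I}"

definition forms :: "'i set \<Rightarrow> nat \<Rightarrow> ('i, 'a::field) mpoly set" where
  "forms I t = {p \<in> polys I. \<forall>m\<in>Poly_Mapping.keys p. mono_deg m = t}"

definition poly_ring :: "'i set \<Rightarrow> ('i, 'a::field) mpoly ring" where
  "poly_ring I = \<lparr>carrier = polys I, monoid.mult = (*), one = 1, zero = 0, add = (+)\<rparr>"


section \<open>Closed subschemes of projective space\<close>

text \<open>
  Closed subschemes of \<open>\<P>(K\<^sup>I)\<close> correspond bijectively to saturated homogeneous ideals of the
  homogeneous coordinate ring, with inclusions reversed; a subscheme is represented by its ideal.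
  Saturation: a polynomial that is multiplied into the ideal by a power of the irrelevant ideal
  already belongs to the ideal.
\<close>

definition closed_subscheme :: "'i set \<Rightarrow> ('i, 'a::field) mpoly set \<Rightarrow> bool" where
  "closed_subscheme I Z \<longleftrightarrow>
     ideal Z (poly_ring I) \<and>
     (\<forall>p\<in>Z. \<forall>t. hom_part t p \<in> Z) \<and>
     (\<forall>p\<in>polys I. (\<exists>k. \<forall>q\<in>forms I k. q * p \<in> Z) \<longrightarrow> p \<in> Z)"

text \<open>
  The ideal of a set of points, i.e. of its Zariski closure with the reduced scheme structure. Since
  a point is a whole line of vectors and \<open>K\<close> is infinite, this ideal is homogeneous.
\<close>

definition vanishing_ideal ::
    "'i set \<Rightarrow> ('i \<Rightarrow> 'a::field) set set \<Rightarrow> ('i, 'a) mpoly set" where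
  "vanishing_ideal I S = {p \<in> polys I. \<forall>P\<in>S. \<forall>v\<in>P. mpoly_eval v p = 0}"

text \<open>The ideal of the associated reduced scheme.\<close>

definition radical_ideal :: "'i set \<Rightarrow> ('i, 'a::field) mpoly set \<Rightarrow> ('i, 'a) mpoly set" where
  "radical_ideal I Z = {p \<in> polys I. \<exists>k. p ^ k \<in> Z}"

definition hilbert_function :: "'i set \<Rightarrow> ('i, 'a::field) mpoly set \<Rightarrow> nat \<Rightarrow> nat" where
  "hilbert_function I Z t =
     mpoly_vs.dim (forms I t :: ('i, 'a) mpoly set) - mpoly_vs.dim (Z \<inter> forms I t)"

text \<open>
  A subscheme is zero-dimensional of degree \<open>k > 0\<close> iff its Hilbert polynomial is the constant \<open>k\<close>.
\<close>

definition zero_dim_of_degree :: "'i set \<Rightarrow> ('i, 'a::field) mpoly set \<Rightarrow> nat \<Rightarrow> bool" where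
  "zero_dim_of_degree I Z k \<longleftrightarrow> k > 0 \<and> (\<exists>t0. \<forall>t\<ge>t0. hilbert_function I Z t = k)"

text \<open>The smallest linear subspace containing a subscheme.\<close>

definition scheme_span ::
    "'i set \<Rightarrow> ('i, 'a::field) mpoly set \<Rightarrow> ('i \<Rightarrow> 'a) set set" where
  "scheme_span I Z = \<Inter>{L. linear_subspace I L \<and> vanishing_ideal I L \<subseteq> Z}"

text \<open>
  The embedded projective tangent space at \<open>Q\<close> of the closed set \<open>X\<close>: the projectivisation of the
  tangent space to the affine cone over \<open>X\<close> at a nonzero vector of \<open>Q\<close>.
\<close>

definition tangent_space ::
    "'i set \<Rightarrow> ('i \<Rightarrow> 'a::field) set set \<Rightarrow> ('i \<Rightarrow> 'a) set \<Rightarrow> ('i \<Rightarrow> 'a) set set" where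
  "tangent_space I X Q =
     proj {w \<in> coord_space I. \<forall>p\<in>vanishing_ideal I X. \<forall>v\<in>Q. v \<noteq> 0 \<longrightarrow>
             (\<Sum>i\<in>I. mpoly_eval v (mpoly_partial i p) * w i) = 0}"

definition tangent_developable ::
    "'i set \<Rightarrow> ('i \<Rightarrow> 'a::field) set set \<Rightarrow> ('i \<Rightarrow> 'a) set set" where
  "tangent_developable I X = (\<Union>Q\<in>X. tangent_space I X Q)"

definition rank_wrt :: "('i \<Rightarrow> 'a::field) set set \<Rightarrow> ('i \<Rightarrow> 'a) set \<Rightarrow> nat" where
  "rank_wrt X P = (LEAST k. \<exists>S. finite S \<and> S \<subseteq> X \<and> card S = k \<and> P \<in> lin_span S)"


section \<open>The Segre variety\<close>

text \<open>
  The factors are \<open>V\<^sub>i = coord_space {0..n i}\<close> for \<open>i = 1, ..., d\<close>; coordinates on \<open>V\<^sub>1 \<otimes> ... \<otimes> V\<^sub>d\<close> are labelled by the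
  multi-indices \<open>(a\<^sub>1, ..., a\<^sub>d)\<close> with \<open>0 \<le> a\<^sub>i \<le> n\<^sub>i\<close>.
\<close>

definition multi_idx :: "nat \<Rightarrow> (nat \<Rightarrow> nat) \<Rightarrow> (nat \<Rightarrow> nat) set" where
  "multi_idx d n = (\<Pi>\<^sub>E i\<in>{1..d}. {0..n i})"

definition pure_tensor ::
    "nat \<Rightarrow> (nat \<Rightarrow> nat) \<Rightarrow> (nat \<Rightarrow> nat \<Rightarrow> 'a::field) \<Rightarrow> (nat \<Rightarrow> nat) \<Rightarrow> 'a" where
  "pure_tensor d n v = (\<lambda>a. if a \<in> multi_idx d n then \<Prod>i\<in>{1..d}. v i (a i) else 0)"

definition multi_proj :: "nat \<Rightarrow> (nat \<Rightarrow> nat) \<Rightarrow> (nat \<Rightarrow> (nat \<Rightarrow> 'a::field) set) set" where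
  "multi_proj d n = (\<Pi>\<^sub>E i\<in>{1..d}. proj_space {0..n i})"

text \<open>
  The tensors \<open>v\<^sub>1 \<otimes> ... \<otimes> v\<^sub>d\<close> with \<open>v\<^sub>i\<close> on the line \<open>Q\<^sub>i\<close> are all proportional, so their span is a
  line, the image of \<open>(Q\<^sub>1, ..., Q\<^sub>d)\<close> under the Segre embedding.
\<close>

definition segre ::
    "nat \<Rightarrow> (nat \<Rightarrow> nat) \<Rightarrow> (nat \<Rightarrow> (nat \<Rightarrow> 'a::field) set) \<Rightarrow> ((nat \<Rightarrow> nat) \<Rightarrow> 'a) set" where
  "segre d n Q = fun_vs.span {pure_tensor d n v | v. \<forall>i\<in>{1..d}. v i \<in> Q i}"

definition segre_variety :: "nat \<Rightarrow> (nat \<Rightarrow> nat) \<Rightarrow> ((nat \<Rightarrow> nat) \<Rightarrow> 'a::field) set set" where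
  "segre_variety d n = segre d n ` multi_proj d n"

text \<open>As the Segre map is injective, exactly one \<open>Q\<close> contributes to the following set.\<close>

definition factor_space ::
    "nat \<Rightarrow> (nat \<Rightarrow> nat) \<Rightarrow> ((nat \<Rightarrow> nat) \<Rightarrow> 'a::field) set \<Rightarrow> nat \<Rightarrow>
      ((nat \<Rightarrow> nat) \<Rightarrow> 'a) set set" where
  "factor_space d n R i =
     {segre d n (Q(i := T)) | Q T. Q \<in> multi_proj d n \<and> segre d n Q = R \<and> T \<in> proj_space {0..n i}}"

definition segre_tangent_developable ::
    "nat \<Rightarrow> (nat \<Rightarrow> nat) \<Rightarrow> ((nat \<Rightarrow> nat) \<Rightarrow> 'a::field) set set" where
  "segre_tangent_developable d n = tangent_developable (multi_idx d n) (segre_variety d n)"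

text \<open>Pairs of a point \<open>R\<close> of the Segre variety \<open>X\<close> and a degree two subscheme of \<open>X\<close> supported at \<open>R\<close>.\<close>

definition tangent_vectors ::
    "nat \<Rightarrow> (nat \<Rightarrow> nat) \<Rightarrow>
      (((nat \<Rightarrow> nat) \<Rightarrow> 'a::field) set \<times> (nat \<Rightarrow> nat, 'a) mpoly set) set" where
  "tangent_vectors d n =
     {(R, Z). R \<in> segre_variety d n \<and>
        closed_subscheme (multi_idx d n) Z \<and>
        vanishing_ideal (multi_idx d n) (segre_variety d n) \<subseteq> Z \<and>
        radical_ideal (multi_idx d n) Z = vanishing_ideal (multi_idx d n) {R} \<and>
        zero_dim_of_degree (multi_idx d n) Z 2}"

text \<open>For a point \<open>P\<close> outside the tangent developable there is no such \<open>E\<close> and the value is unspecified.\<close>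

definition tensor_type ::
    "nat \<Rightarrow> (nat \<Rightarrow> nat) \<Rightarrow> ((nat \<Rightarrow> nat) \<Rightarrow> 'a::field) set \<Rightarrow> nat" where
  "tensor_type d n P =
     (if P \<in> segre_variety d n then 1
      else LEAST k. \<exists>R Z E. (R, Z) \<in> tangent_vectors d n \<and> E \<subseteq> {1..d} \<and> card E = k \<and>
             P \<in> scheme_span (multi_idx d n) Z \<and>
             scheme_span (multi_idx d n) Z \<subseteq> lin_span (\<Union>i\<in>E. factor_space d n R i))"

end

theory Submission
  imports Defs
begin

text \<open>
  Let \<open>T = v\<^sub>1 \<otimes> ... \<otimes> v\<^sub>d\<close>. The quadrics \<open>x\<^sub>a x\<^sub>b - x\<^sub>a\<^sub>' x\<^sub>b\<^sub>'\<close>, where \<open>a', b'\<close> arise from \<open>a, b\<close> by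
  exchanging one index, show that every tangent vector at \<open>T\<close> has the form
  \<open>w = c T + \<Sum>\<^sub>i v\<^sub>1 \<otimes> ... \<otimes> w\<^sub>i \<otimes> ... \<otimes> v\<^sub>d\<close>, where \<open>w\<^sub>i\<close> is zero or independent of \<open>v\<^sub>i\<close>. Let \<open>E\<close> be the set of
  all \<open>i\<close> with \<open>w\<^sub>i \<noteq> 0\<close>. The degree two scheme at \<open>T\<close> in direction \<open>w - c T\<close> shows that the type of
  \<open>w\<close> is at most \<open>|E|\<close>, and the substitution method shows that the rank of \<open>w\<close> is at least \<open>|E|\<close>.
  Conversely, a vector in the span of the \<open>Y\<^bsub>O,i\<^esub>\<close> with \<open>i \<in> E'\<close> is a sum of \<open>|E'|\<close> pure tensors, so
  the rank is at most the type.
\<close>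

section \<open>Polynomials along curves\<close>

lemma sum_fun_apply: "sum f A x = (\<Sum>a\<in>A. f a x)"
  by (induction A rule: infinite_finite_induct) auto

text \<open>Together with \<open>mpoly_subst\<close>, the restriction of polynomials to a curve with
  parameter t; first-order behaviour is read off modulo t^2.\<close>

definition monom_subst :: "('i \<Rightarrow> 'a::field poly) \<Rightarrow> ('i \<Rightarrow>\<^sub>0 nat) \<Rightarrow> 'a poly" where
  "monom_subst \<phi> m = (\<Prod>i\<in>Poly_Mapping.keys m. \<phi> i ^ Poly_Mapping.lookup m i)"

definition mpoly_subst :: "('i \<Rightarrow> 'a::field poly) \<Rightarrow> ('i, 'a) mpoly \<Rightarrow> 'a poly" where
  "mpoly_subst \<phi> p =
     (\<Sum>m\<in>Poly_Mapping.keys p. smult (Poly_Mapping.lookup p m) (monom_subst \<phi> m))"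

lemma monom_subst_superset:
  assumes "finite A" "Poly_Mapping.keys m \<subseteq> A"
  shows "monom_subst \<phi> m = (\<Prod>i\<in>A. \<phi> i ^ Poly_Mapping.lookup m i)"
  unfolding monom_subst_def using assms
  by (intro prod.mono_neutral_left) (auto simp: in_keys_iff)

lemma mpoly_subst_superset:
  assumes "finite A" "Poly_Mapping.keys p \<subseteq> A"
  shows "mpoly_subst \<phi> p = (\<Sum>m\<in>A. smult (Poly_Mapping.lookup p m) (monom_subst \<phi> m))"
  unfolding mpoly_subst_def using assms
  by (intro sum.mono_neutral_left) (auto simp: in_keys_iff)

lemma monom_subst_0 [simp]: "monom_subst \<phi> 0 = 1"
  by (simp add: monom_subst_def)

lemma monom_subst_single [simp]: "monom_subst \<phi> (Poly_Mapping.single i k) = \<phi> i ^ k"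
  by (simp add: monom_subst_def)

lemma monom_subst_add: "monom_subst \<phi> (m + m') = monom_subst \<phi> m * monom_subst \<phi> m'"
proof -
  let ?A = "Poly_Mapping.keys m \<union> Poly_Mapping.keys m'"
  have "monom_subst \<phi> (m + m') = (\<Prod>i\<in>?A. \<phi> i ^ Poly_Mapping.lookup (m + m') i)"
    using Poly_Mapping.keys_add[of m m'] by (intro monom_subst_superset) auto
  moreover have "monom_subst \<phi> m = (\<Prod>i\<in>?A. \<phi> i ^ Poly_Mapping.lookup m i)"
    "monom_subst \<phi> m' = (\<Prod>i\<in>?A. \<phi> i ^ Poly_Mapping.lookup m' i)"
    by (rule monom_subst_superset; auto)+
  ultimately show ?thesis
    by (simp add: lookup_add power_add prod.distrib)
qed

lemma mpoly_subst_0 [simp]: "mpoly_subst \<phi> 0 = 0"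
  by (simp add: mpoly_subst_def)

lemma mpoly_subst_single [simp]:
  "mpoly_subst \<phi> (Poly_Mapping.single m c) = smult c (monom_subst \<phi> m)"
  by (simp add: mpoly_subst_def)

lemma mpoly_subst_1 [simp]: "mpoly_subst \<phi> 1 = 1"
  using mpoly_subst_single[of \<phi> 0 1] by simp

lemma mpoly_subst_add: "mpoly_subst \<phi> (p + q) = mpoly_subst \<phi> p + mpoly_subst \<phi> q"
proof -
  let ?A = "Poly_Mapping.keys p \<union> Poly_Mapping.keys q"
  have "mpoly_subst \<phi> (p + q) =
      (\<Sum>m\<in>?A. smult (Poly_Mapping.lookup (p + q) m) (monom_subst \<phi> m))"
    using Poly_Mapping.keys_add[of p q] by (intro mpoly_subst_superset) auto
  moreover have
    "mpoly_subst \<phi> p = (\<Sum>m\<in>?A. smult (Poly_Mapping.lookup p m) (monom_subst \<phi> m))"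
    "mpoly_subst \<phi> q = (\<Sum>m\<in>?A. smult (Poly_Mapping.lookup q m) (monom_subst \<phi> m))"
    by (rule mpoly_subst_superset; auto)+
  ultimately show ?thesis
    by (simp add: lookup_add smult_add_left sum.distrib)
qed

lemma mpoly_subst_uminus: "mpoly_subst \<phi> (- p) = - mpoly_subst \<phi> p"
  using mpoly_subst_add[of \<phi> p "- p"] by (simp add: eq_neg_iff_add_eq_0 add.commute)

lemma mpoly_subst_diff: "mpoly_subst \<phi> (p - q) = mpoly_subst \<phi> p - mpoly_subst \<phi> q"
  using mpoly_subst_add[of \<phi> p "- q"] by (simp add: mpoly_subst_uminus)

lemma mpoly_subst_sum: "mpoly_subst \<phi> (sum f A) = (\<Sum>a\<in>A. mpoly_subst \<phi> (f a))"
  by (induction A rule: infinite_finite_induct) (auto simp: mpoly_subst_add)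

lemma mpoly_sum_monoms:
  "(\<Sum>m\<in>Poly_Mapping.keys p. Poly_Mapping.single m (Poly_Mapping.lookup p m)) = p"
  by (rule poly_mapping_eqI) (auto simp: lookup_sum lookup_single when_def in_keys_iff)

lemma mpoly_subst_mult: "mpoly_subst \<phi> (p * q) = mpoly_subst \<phi> p * mpoly_subst \<phi> q"
proof -
  let ?s = "\<lambda>p m. Poly_Mapping.single m (Poly_Mapping.lookup p m)"
  have "p * q = (\<Sum>m\<in>Poly_Mapping.keys p. ?s p m) * (\<Sum>m\<in>Poly_Mapping.keys q. ?s q m)"
    by (simp add: mpoly_sum_monoms)
  also have "mpoly_subst \<phi> \<dots> =
      (\<Sum>m\<in>Poly_Mapping.keys p. mpoly_subst \<phi> (?s p m)) *
      (\<Sum>m\<in>Poly_Mapping.keys q. mpoly_subst \<phi> (?s q m))"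
    unfolding sum_product mpoly_subst_sum mult_single
    by (simp add: monom_subst_add mult.commute)
  finally show ?thesis
    unfolding mpoly_subst_single by (simp only: mpoly_subst_def)
qed

lemma mpoly_subst_power: "mpoly_subst \<phi> (p ^ k) = mpoly_subst \<phi> p ^ k"
  by (induction k) (auto simp: mpoly_subst_mult)

lemma mpoly_subst_scale: "mpoly_subst \<phi> (mpoly_scale c p) = smult c (mpoly_subst \<phi> p)"
  by (simp add: mpoly_scale_def mpoly_subst_mult)

text \<open>Links values to coefficients: over an infinite field, a polynomial that vanishes along a
  whole curve restricts to the zero polynomial.\<close>

lemma poly_mpoly_subst: "poly (mpoly_subst \<phi> p) t = mpoly_eval (\<lambda>i. poly (\<phi> i) t) p"
  by (simp add: mpoly_subst_def mpoly_eval_def poly_sum monom_subst_def poly_prod poly_power)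

text \<open>Evaluation is substitution of constants, so it inherits the homomorphism laws.\<close>

lemma mpoly_eval_conv_subst: "mpoly_eval v p = poly (mpoly_subst (\<lambda>i. [:v i:]) p) 0"
  by (simp add: poly_mpoly_subst)

lemma mpoly_eval_single [simp]:
  "mpoly_eval v (Poly_Mapping.single (Poly_Mapping.single i 1) c) = c * v i"
  by (simp add: mpoly_eval_conv_subst)

lemma mpoly_eval_diff: "mpoly_eval v (p - q) = mpoly_eval v p - mpoly_eval v q"
  by (simp add: mpoly_eval_conv_subst mpoly_subst_diff)

lemma mpoly_eval_mult: "mpoly_eval v (p * q) = mpoly_eval v p * mpoly_eval v q"
  by (simp add: mpoly_eval_conv_subst mpoly_subst_mult)

text \<open>\<open>[:0,0,1:]\<close> is t^2, so divisibility by it expresses vanishing to second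
  order at t = 0.\<close>

lemma cong_t2_iff:
  fixes f :: "'a::field poly"
  shows "[:0,0,1:] dvd f \<longleftrightarrow> coeff f 0 = 0 \<and> coeff f 1 = 0"
proof
  assume "[:0,0,1:] dvd f"
  then obtain g where "f = [:0,0,1:] * g" ..
  then show "coeff f 0 = 0 \<and> coeff f 1 = 0" by simp
next
  assume *: "coeff f 0 = 0 \<and> coeff f 1 = 0"
  obtain a g where g: "f = pCons a g" by (cases f)
  obtain b h where h: "g = pCons b h" by (cases g)
  have "f = [:0,0,1:] * h" using * g h by simp
  then show "[:0,0,1:] dvd f" by (rule dvdI)
qed

lemma dvd_diff_prod:
  fixes f g :: "'b \<Rightarrow> 'a::comm_ring_1"
  assumes "\<And>i. i \<in> A \<Longrightarrow> m dvd f i - g i"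
  shows "m dvd prod f A - prod g A"
  using assms
proof (induction A rule: infinite_finite_induct)
  case (insert x A)
  have "prod f (insert x A) - prod g (insert x A) =
      f x * (prod f A - prod g A) + (f x - g x) * prod g A"
    using insert.hyps by (simp add: algebra_simps)
  then show ?case using insert by auto
qed auto

lemma dvd_diff_power:
  fixes f g :: "'a::comm_ring_1"
  assumes "m dvd f - g"
  shows "m dvd f ^ k - g ^ k"
  using dvd_diff_prod[of "{..<k}" m "\<lambda>_. f" "\<lambda>_. g"] assms by simp

text \<open>For the modulus t^2: a tangent line may be exchanged for any curve with the same
  first-order part, such as one on the Segre variety.\<close>

lemma dvd_diff_mpoly_subst:
  assumes "\<And>i. m dvd \<phi> i - \<psi> i"
  shows "m dvd mpoly_subst \<phi> p - mpoly_subst \<psi> p"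
proof -
  have "m dvd monom_subst \<phi> k - monom_subst \<psi> k" for k
    unfolding monom_subst_def by (intro dvd_diff_prod dvd_diff_power assms)
  then show ?thesis
    unfolding mpoly_subst_def sum_subtractf[symmetric] smult_diff_right[symmetric]
    by (intro dvd_sum dvd_smult)
qed

section \<open>Formal partial derivatives\<close>

lemma mpoly_partial_add: "mpoly_partial i (p + q) = mpoly_partial i p + mpoly_partial i q"
proof -
  let ?f = "\<lambda>p m. Poly_Mapping.single (m - Poly_Mapping.single i 1)
          (of_nat (Poly_Mapping.lookup m i) * Poly_Mapping.lookup p m)"
  let ?A = "Poly_Mapping.keys p \<union> Poly_Mapping.keys q"
  have *: "mpoly_partial i r = (\<Sum>m\<in>?A. ?f r m)" if "Poly_Mapping.keys r \<subseteq> ?A" for r :: "('a, 'b) mpoly"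
    unfolding mpoly_partial_def using that
    by (intro sum.mono_neutral_left) (auto simp: in_keys_iff)
  show ?thesis
    using Poly_Mapping.keys_add[of p q]
    by (simp add: * lookup_add algebra_simps single_add sum.distrib)
qed

lemma mpoly_partial_single:
  "mpoly_partial i (Poly_Mapping.single m c) =
     Poly_Mapping.single (m - Poly_Mapping.single i 1) (of_nat (Poly_Mapping.lookup m i) * c)"
  by (simp add: mpoly_partial_def)

lemma mpoly_partial_diff: "mpoly_partial i (p - q) = mpoly_partial i p - mpoly_partial i q"
  using mpoly_partial_add[of i "p - q" q] by simp

abbreviation mvar :: "'i \<Rightarrow> ('i, 'a::field) mpoly" where
  "mvar i \<equiv> Poly_Mapping.single (Poly_Mapping.single i 1) 1"

text \<open>Product rule for the quadratic monomials from which the equations of the Segre variety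
  are built; for \<open>a = b\<close> both terms count.\<close>

lemma eval_partial_mvar_mult:
  "mpoly_eval v (mpoly_partial i (mvar a * mvar b)) =
     (if i = a then v b else 0) + (if i = b then v a else 0)"
  unfolding mult_single mpoly_partial_single
  by (auto simp: lookup_add lookup_single mpoly_eval_conv_subst)

lemma derivative_mvar_mult:
  assumes "finite I" "a \<in> I" "b \<in> I"
  shows "(\<Sum>i\<in>I. mpoly_eval v (mpoly_partial i (mvar a * mvar b)) * w i) = v b * w a + v a * w b"
  unfolding eval_partial_mvar_mult using assms
  by (simp add: distrib_right sum.distrib if_distrib[of "\<lambda>x. x * _"] cong: if_cong)

section \<open>Degree two subschemes supported at a point\<close>

lemma polysI: "(\<And>m. m \<in> Poly_Mapping.keys p \<Longrightarrow> Poly_Mapping.keys m \<subseteq> I) \<Longrightarrow> p \<in> polys I"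
  by (simp add: polys_def)

lemma polys_0 [simp]: "0 \<in> polys I"
  by (simp add: polys_def)

lemma polys_1 [simp]: "1 \<in> polys I"
  by (simp add: polys_def)

lemma polys_add: "p \<in> polys I \<Longrightarrow> q \<in> polys I \<Longrightarrow> p + q \<in> polys I"
  using Poly_Mapping.keys_add[of p q] unfolding polys_def by blast

lemma polys_uminus: "p \<in> polys I \<Longrightarrow> - p \<in> polys I"
  by (simp add: polys_def)

lemma polys_diff: "p \<in> polys I \<Longrightarrow> q \<in> polys I \<Longrightarrow> p - q \<in> polys I"
  using polys_add[of p I "- q"] by (simp add: polys_uminus)

lemma polys_mult:
  assumes "p \<in> polys I" "q \<in> polys I"
  shows "p * q \<in> polys I"
proof (rule polysI)
  fix m assume "m \<in> Poly_Mapping.keys (p * q)"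
  then obtain a b where "m = a + b" "a \<in> Poly_Mapping.keys p" "b \<in> Poly_Mapping.keys q"
    using Poly_Mapping.keys_mult[of p q] by blast
  then show "Poly_Mapping.keys m \<subseteq> I"
    using assms Poly_Mapping.keys_add[of a b] unfolding polys_def by blast
qed

lemma polys_power: "p \<in> polys I \<Longrightarrow> p ^ k \<in> polys I"
  by (induction k) (auto intro: polys_mult)

lemma mvar_polys: "i \<in> I \<Longrightarrow> Poly_Mapping.single (Poly_Mapping.single i 1) c \<in> polys I"
  by (simp add: polys_def)

lemma ring_poly_ring: "ring (poly_ring I)"
proof (rule ringI)
  show "abelian_group (poly_ring I)"
    by (rule abelian_groupI)
      (auto simp: poly_ring_def polys_add add.assoc add.commute
        intro!: bexI[of _ "- _"] polys_uminus)
  show "monoid (poly_ring I)"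
    by (rule monoidI) (auto simp: poly_ring_def polys_mult mult.assoc)
qed (auto simp: poly_ring_def algebra_simps)

lemma a_inv_poly_ring: "p \<in> polys I \<Longrightarrow> \<ominus>\<^bsub>poly_ring I\<^esub> p = - p"
  using abelian_group.minus_equality[OF ring.is_abelian_group[OF ring_poly_ring, of I], of "- p" p]
  by (simp add: poly_ring_def polys_uminus)

lemma ideal_poly_ringI:
  fixes Z :: "('i, 'a::field) mpoly set"
  assumes "Z \<subseteq> polys I" "0 \<in> Z" "\<And>p q. p \<in> Z \<Longrightarrow> q \<in> Z \<Longrightarrow> p + q \<in> Z"
    "\<And>p q. p \<in> Z \<Longrightarrow> q \<in> polys I \<Longrightarrow> q * p \<in> Z"
  shows "ideal Z (poly_ring I)"
proof (rule idealI)
  show "ring (poly_ring I :: ('i, 'a) mpoly ring)"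
    by (rule ring_poly_ring)
  have "- p \<in> Z" if "p \<in> Z" for p
    using assms(4)[OF that, of "- 1"] by (simp add: polys_uminus)
  moreover have "inv\<^bsub>add_monoid (poly_ring I)\<^esub> p = - p" if "p \<in> Z" for p
    using a_inv_poly_ring[of p I] that assms(1) by (auto simp: a_inv_def)
  ultimately show "subgroup Z (add_monoid (poly_ring I))"
    using assms
    by (intro subgroup.intro) (auto simp: poly_ring_def subset_iff)
qed (use assms in \<open>auto simp: poly_ring_def mult.commute\<close>)

section \<open>Degrees and homogeneous parts\<close>

lemma mono_deg_superset:
  assumes "finite A" "Poly_Mapping.keys m \<subseteq> A"
  shows "mono_deg m = (\<Sum>i\<in>A. Poly_Mapping.lookup m i)"
  unfolding mono_deg_def using assms
  by (intro sum.mono_neutral_left) (auto simp: in_keys_iff)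

lemma mono_deg_add: "mono_deg (m + m') = mono_deg m + mono_deg m'"
proof -
  let ?A = "Poly_Mapping.keys m \<union> Poly_Mapping.keys m'"
  have "mono_deg (m + m') = (\<Sum>i\<in>?A. Poly_Mapping.lookup (m + m') i)"
    using Poly_Mapping.keys_add[of m m'] by (intro mono_deg_superset) auto
  moreover have "mono_deg m = (\<Sum>i\<in>?A. Poly_Mapping.lookup m i)"
    "mono_deg m' = (\<Sum>i\<in>?A. Poly_Mapping.lookup m' i)"
    by (rule mono_deg_superset; auto)+
  ultimately show ?thesis
    by (simp add: lookup_add sum.distrib)
qed

lemma monom_subst_smult:
  "monom_subst (\<lambda>i. smult c (\<phi> i)) m = smult (c ^ mono_deg m) (monom_subst \<phi> m)"
  by (simp add: monom_subst_def mono_deg_def smult_power prod_smult power_sum)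

lemma lookup_hom_part:
  "Poly_Mapping.lookup (hom_part t p) m = (if mono_deg m = t then Poly_Mapping.lookup p m else 0)"
  by (auto simp: hom_part_def lookup_sum lookup_single when_def in_keys_iff)

lemma keys_hom_part: "Poly_Mapping.keys (hom_part t p) = {m \<in> Poly_Mapping.keys p. mono_deg m = t}"
  by (auto simp: in_keys_iff lookup_hom_part split: if_splits)

lemma hom_part_polys: "p \<in> polys I \<Longrightarrow> hom_part t p \<in> polys I"
  by (auto simp: polys_def keys_hom_part)

lemma hom_part_in_forms: "p \<in> polys I \<Longrightarrow> hom_part t p \<in> forms I t"
  by (simp add: forms_def hom_part_polys keys_hom_part)

lemma sum_hom_parts: "(\<Sum>t\<in>mono_deg ` Poly_Mapping.keys p. hom_part t p) = p"
  by (rule poly_mapping_eqI) (auto simp: lookup_sum lookup_hom_part in_keys_iff)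

lemma smult_sum_right: "smult c (sum f A) = (\<Sum>a\<in>A. smult c (f a))"
  by (induction A rule: infinite_finite_induct) (auto simp: smult_add_right)

lemma mpoly_subst_smult_form:
  assumes "p \<in> forms I t"
  shows "mpoly_subst (\<lambda>i. smult c (\<phi> i)) p = smult (c ^ t) (mpoly_subst \<phi> p)"
proof -
  have "mpoly_subst (\<lambda>i. smult c (\<phi> i)) p =
    (\<Sum>m\<in>Poly_Mapping.keys p. smult (c ^ t) (smult (Poly_Mapping.lookup p m) (monom_subst \<phi> m)))"
    unfolding mpoly_subst_def monom_subst_smult using assms
    by (intro sum.cong) (auto simp: forms_def mult.commute)
  also have "\<dots> = smult (c ^ t) (mpoly_subst \<phi> p)"
    by (simp only: mpoly_subst_def smult_sum_right)
  finally show ?thesis .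
qed

text \<open>The restriction becomes a polynomial in c whose coefficient at \<open>c ^ t\<close>
  comes from the degree \<open>t\<close> part, which lets the parts be separated.\<close>

lemma mpoly_subst_smult:
  assumes "p \<in> polys I"
  shows "mpoly_subst (\<lambda>i. smult c (\<phi> i)) p =
    (\<Sum>t\<in>mono_deg ` Poly_Mapping.keys p. smult (c ^ t) (mpoly_subst \<phi> (hom_part t p)))"
proof -
  have "mpoly_subst (\<lambda>i. smult c (\<phi> i)) p =
    (\<Sum>t\<in>mono_deg ` Poly_Mapping.keys p. mpoly_subst (\<lambda>i. smult c (\<phi> i)) (hom_part t p))"
    by (subst sum_hom_parts[symmetric]) (rule mpoly_subst_sum)
  then show ?thesis
    by (simp only: mpoly_subst_smult_form[OF hom_part_in_forms[OF assms]])
qed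

text \<open>A polynomial in c with infinitely many zeros is zero; characteristic 0 supplies
  infinitely many nonzero scalars.\<close>

lemma coeff_subst_hom_part_zero:
  fixes p :: "('i, 'a::field_char_0) mpoly"
  assumes "p \<in> polys I" and "\<And>c. c \<noteq> 0 \<Longrightarrow> coeff (mpoly_subst (\<lambda>i. smult c (\<phi> i)) p) j = 0"
  shows "coeff (mpoly_subst \<phi> (hom_part t p)) j = 0"
proof (cases "t \<in> mono_deg ` Poly_Mapping.keys p")
  case True
  \<comment> \<open>The j-th coefficient along the curve, as a polynomial in the scaling factor
    c.\<close>
  define f where "f = (\<Sum>t\<in>mono_deg ` Poly_Mapping.keys p.
      monom (coeff (mpoly_subst \<phi> (hom_part t p)) j) t)"
  have "poly f c = 0" if "c \<noteq> 0" for c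
    using assms(2)[OF that] unfolding mpoly_subst_smult[OF assms(1)]
    by (simp add: f_def poly_sum poly_monom coeff_sum mult.commute)
  then have "- {0} \<subseteq> {c. poly f c = 0}" by auto
  moreover have "infinite (- {0::'a})"
    by (simp add: finite_compl infinite_UNIV_char_0)
  ultimately have "f = 0"
    using poly_roots_finite[of f] finite_subset by blast
  then have "coeff f t = 0" by simp
  then show ?thesis
    using True by (simp add: f_def coeff_sum coeff_monom)
next
  case False
  then have "hom_part t p = 0"
    by (intro poly_mapping_eqI) (auto simp: lookup_hom_part in_keys_iff)
  then show ?thesis by simp
qed

text \<open>
  The scheme with homogeneous ideal \<open>double_point I v u\<close> is the tangent vector in direction \<open>u\<close> at the
  point \<open>v\<close>: it consists of the polynomials vanishing to second order at \<open>t = 0\<close> along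
  \<open>c (v + t u)\<close> for every scalar \<open>c\<close>.
\<close>

definition double_point :: "'i set \<Rightarrow> ('i \<Rightarrow> 'a) \<Rightarrow> ('i \<Rightarrow> 'a) \<Rightarrow> ('i, 'a::field) mpoly set" where
  "double_point I v u =
     {p \<in> polys I. \<forall>c. [:0,0,1:] dvd mpoly_subst (\<lambda>i. smult c [:v i, u i:]) p}"

text \<open>Rescaling multiplies the restriction of a form by \<open>c ^ t\<close>, so the value c =
  1 alone decides membership.\<close>

lemma double_point_form_iff:
  assumes "p \<in> forms I t"
  shows "p \<in> double_point I v u \<longleftrightarrow> [:0,0,1:] dvd mpoly_subst (\<lambda>i. [:v i, u i:]) p"
proof -
  have "p \<in> polys I" using assms by (simp add: forms_def)
  moreover have "(\<forall>c. [:0,0,1:] dvd smult (c ^ t) f) \<longleftrightarrow> [:0,0,1:] dvd f" for f :: "'b poly"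
  proof
    assume "\<forall>c. [:0,0,1:] dvd smult (c ^ t) f"
    from spec[OF this, of 1] show "[:0,0,1:] dvd f" by simp
  qed (auto intro: dvd_smult)
  moreover have "mpoly_subst (\<lambda>i. smult c [:v i, u i:]) p =
      smult (c ^ t) (mpoly_subst (\<lambda>i. [:v i, u i:]) p)" for c
    by (rule mpoly_subst_smult_form[OF assms])
  ultimately show ?thesis
    unfolding double_point_def by (simp del: smult_pCons)
qed

text \<open>Nonzero c suffice to isolate the homogeneous parts, which then give the case c = 0.
  Saturation needs this version, since there a power of c is cancelled.\<close>

lemma double_point_iff_hom_part:
  fixes p :: "('i, 'a::field_char_0) mpoly"
  assumes "p \<in> polys I"
    and "\<And>c. c \<noteq> 0 \<Longrightarrow> [:0,0,1:] dvd mpoly_subst (\<lambda>i. smult c [:v i, u i:]) p"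
  shows "hom_part t p \<in> double_point I v u" and "p \<in> double_point I v u"
proof -
  have *: "[:0,0,1:] dvd mpoly_subst (\<lambda>i. [:v i, u i:]) (hom_part t p)" for t
    unfolding cong_t2_iff using assms(2)[unfolded cong_t2_iff]
    by (auto intro: coeff_subst_hom_part_zero[OF assms(1)])
  then show "hom_part t p \<in> double_point I v u"
    using double_point_form_iff[OF hom_part_in_forms[OF assms(1)]] by blast
  show "p \<in> double_point I v u"
    using assms(1) * unfolding double_point_def
    by (auto simp only: mem_Collect_eq mpoly_subst_smult[OF assms(1)] intro!: dvd_sum dvd_smult)
qed

lemma ideal_double_point: "ideal (double_point I v u) (poly_ring I)"
  by (rule ideal_poly_ringI)
    (auto simp: double_point_def mpoly_subst_add mpoly_subst_mult
      intro: polys_add polys_mult dvd_add dvd_mult)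

section \<open>Forms of a fixed degree\<close>

lemma mono_deg_single [simp]: "mono_deg (Poly_Mapping.single i k) = k"
  by (simp add: mono_deg_def)

lemma mvar_forms: "i \<in> I \<Longrightarrow> Poly_Mapping.single (Poly_Mapping.single i 1) c \<in> forms I 1"
  using mvar_polys[of i I c] by (auto simp: forms_def)

lemma forms_mult:
  assumes "p \<in> forms I s" "q \<in> forms I t"
  shows "p * q \<in> forms I (s + t)"
  unfolding forms_def
proof (intro CollectI conjI ballI)
  show "p * q \<in> polys I" using assms by (auto simp: forms_def polys_mult)
  fix m assume "m \<in> Poly_Mapping.keys (p * q)"
  then obtain a b where "m = a + b" "a \<in> Poly_Mapping.keys p" "b \<in> Poly_Mapping.keys q"
    using Poly_Mapping.keys_mult[of p q] by blast
  then show "mono_deg m = s + t"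
    using assms by (auto simp: forms_def mono_deg_add)
qed

lemma forms_1: "1 \<in> forms I 0"
  by (auto simp: forms_def mono_deg_def)

lemma forms_power: "p \<in> forms I 1 \<Longrightarrow> p ^ k \<in> forms I k"
  by (induction k) (use forms_mult[of p I 1] in \<open>auto simp: forms_1\<close>)

lemma lookup_mpoly_scale: "Poly_Mapping.lookup (mpoly_scale c p) m = c * Poly_Mapping.lookup p m"
  unfolding mpoly_scale_def mult_map_scale_conv_mult[symmetric]
  by (simp add: Poly_Mapping.map.rep_eq when_def)

lemma subspace_forms: "mpoly_vs.subspace (forms I t :: ('i, 'a::field) mpoly set)"
proof (rule mpoly_vs.subspaceI)
  show "0 \<in> forms I t" by (simp add: forms_def)
next
  fix p q :: "('i, 'a) mpoly" assume "p \<in> forms I t" "q \<in> forms I t"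
  then show "p + q \<in> forms I t"
    using Poly_Mapping.keys_add[of p q] polys_add[of p I q] unfolding forms_def by blast
next
  fix c and p :: "('i, 'a) mpoly" assume p: "p \<in> forms I t"
  have "Poly_Mapping.keys (mpoly_scale c p) \<subseteq> Poly_Mapping.keys p"
    by (auto simp: in_keys_iff lookup_mpoly_scale)
  then show "mpoly_scale c p \<in> forms I t"
    using p unfolding forms_def polys_def by blast
qed

lemma subspace_double_point: "mpoly_vs.subspace (double_point I v u)"
proof (rule mpoly_vs.subspaceI)
  fix c p assume p: "p \<in> double_point I v u"
  have "Poly_Mapping.keys (mpoly_scale c p) \<subseteq> Poly_Mapping.keys p"
    by (auto simp: in_keys_iff lookup_mpoly_scale)
  then have "mpoly_scale c p \<in> polys I"
    using p unfolding double_point_def polys_def by blast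
  then show "mpoly_scale c p \<in> double_point I v u"
    using p by (auto simp: double_point_def mpoly_subst_scale intro: dvd_smult)
qed (auto simp: double_point_def mpoly_subst_add intro: polys_add dvd_add)

text \<open>Exponents are bounded by \<open>t\<close>; this makes the spaces of forms
  finite-dimensional, as the dimension count requires.\<close>

lemma finite_monomials:
  assumes "finite I"
  shows "finite {m. Poly_Mapping.keys m \<subseteq> I \<and> mono_deg m = t}" (is "finite ?M")
proof (rule finite_imageD)
  show "inj_on Poly_Mapping.lookup ?M"
    by (rule inj_onI) (simp add: lookup_inject)
  have "Poly_Mapping.lookup m i \<le> t" if "m \<in> ?M" for m i
  proof (cases "i \<in> I")
    case True
    have "Poly_Mapping.lookup m i \<le> (\<Sum>i\<in>I. Poly_Mapping.lookup m i)"
      using assms True by (intro member_le_sum) auto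
    then show ?thesis using that mono_deg_superset[OF assms, of m] by auto
  next
    case False
    then have "i \<notin> Poly_Mapping.keys m" using that by auto
    then show ?thesis by (simp add: in_keys_iff)
  qed
  then have "Poly_Mapping.lookup ` ?M \<subseteq>
      {f. \<forall>i. (i \<in> I \<longrightarrow> f i \<in> {..t}) \<and> (i \<notin> I \<longrightarrow> f i = 0)}"
    by (auto simp: in_keys_iff subset_iff)
  then show "finite (Poly_Mapping.lookup ` ?M)"
    by (rule finite_subset) (rule finite_set_of_finite_funs, use assms in auto)
qed

lemma forms_subset_span:
  "(forms I t :: ('i, 'a::field) mpoly set) \<subseteq> mpoly_vs.span
     ((\<lambda>m. Poly_Mapping.single m 1) ` {m. Poly_Mapping.keys m \<subseteq> I \<and> mono_deg m = t})"
proof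
  fix p :: "('i, 'a) mpoly" assume p: "p \<in> forms I t"
  have "p = (\<Sum>m\<in>Poly_Mapping.keys p. mpoly_scale (Poly_Mapping.lookup p m) (Poly_Mapping.single m 1))"
    by (simp add: mpoly_scale_def mult_single mpoly_sum_monoms)
  also have "\<dots> \<in> mpoly_vs.span
     ((\<lambda>m. Poly_Mapping.single m 1) ` {m. Poly_Mapping.keys m \<subseteq> I \<and> mono_deg m = t})"
    using p by (intro mpoly_vs.span_sum mpoly_vs.span_scale mpoly_vs.span_base)
      (auto simp: forms_def polys_def)
  finally show "p \<in> \<dots>" .
qed

text \<open>\<open>a\<close> and \<open>b\<close> represent a basis of the quotient of
  \<open>F\<close> by \<open>Z\<close>, so adjoining them to a basis of \<open>Z\<close> gives one
  of \<open>F\<close>.\<close>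

lemma (in vector_space) dim_eq_dim_plus_2:
  assumes F: "finite M" "F \<subseteq> span M" and Z: "subspace Z" "Z \<subseteq> F" and ab: "a \<in> F" "b \<in> F"
    and decomp: "\<And>x. x \<in> F \<Longrightarrow> \<exists>\<alpha> \<beta>. x - scale \<alpha> a - scale \<beta> b \<in> Z"
    and indep: "\<And>\<alpha> \<beta>. scale \<alpha> a + scale \<beta> b \<in> Z \<Longrightarrow> \<alpha> = 0 \<and> \<beta> = 0"
  shows "dim F = dim Z + 2"
proof -
  obtain B where B: "B \<subseteq> Z" "independent B" "Z \<subseteq> span B" "card B = dim Z"
    using basis_exists by blast
  have ZB: "span B = Z"
    using B(1,3) Z(1) span_minimal by blast
  have "finite B"
    using independent_span_bound[OF F(1) B(2)] B(1) Z(2) F(2) by blast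
  have b: "b \<notin> span B"
    using indep[of 0 1] by (auto simp: ZB)
  have a: "a \<notin> span (insert b B)"
    using indep[of 1 "- _"] by (auto simp: ZB span_breakdown_eq)
  have "F \<subseteq> span (insert a (insert b B))"
    using decomp by (auto simp: ZB span_breakdown_eq)
  moreover have "independent (insert a (insert b B))"
    using a b B(2) by (intro independent_insertI)
  ultimately have "card (insert a (insert b B)) = dim F"
    using ab B(1) Z(2) by (intro basis_card_eq_dim) auto
  moreover have "card (insert a (insert b B)) = card B + 2"
  proof -
    have "b \<notin> B" "a \<notin> insert b B" using a b span_base by blast+
    then show ?thesis using \<open>finite B\<close> by simp
  qed
  ultimately show ?thesis by (simp add: B(4))
qed

section \<open>Linear functionals\<close>

lemma mem_span_singleton: "x \<in> fun_vs.span {v} \<longleftrightarrow> (\<exists>c. x = fun_scale c v)"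
  by (auto simp: fun_vs.span_singleton)

lemma vector_space_pair_functionals:
  "vector_space_pair fun_scale ((*) :: 'a \<Rightarrow> 'a \<Rightarrow> 'a::field)"
proof (rule vector_space_pair.intro)
  show "vector_space ((*) :: 'a \<Rightarrow> 'a \<Rightarrow> 'a)"
    by unfold_locales (simp_all add: distrib_left distrib_right mult.assoc)
qed (rule fun_vs.vector_space_axioms)

text \<open>Extend a basis of \<open>W\<close> by \<open>x\<close>, and let the functional be 1 at
  \<open>x\<close> and 0 on the basis; \<open>f\<close> lists its values at the unit
  vectors.\<close>

lemma separating_functional:
  fixes x :: "'i \<Rightarrow> 'a::field"
  assumes "finite I" and W: "fun_vs.subspace W" "W \<subseteq> coord_space I"
    and x: "x \<in> coord_space I" "x \<notin> W"
  obtains f where "\<And>y. y \<in> W \<Longrightarrow> (\<Sum>i\<in>I. f i * y i) = 0" "(\<Sum>i\<in>I. f i * x i) \<noteq> 0"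
proof -
  interpret pair: vector_space_pair fun_scale "(*) :: 'a \<Rightarrow> 'a \<Rightarrow> 'a"
    by (rule vector_space_pair_functionals)
  obtain B where B: "B \<subseteq> W" "fun_vs.independent B" "W \<subseteq> fun_vs.span B"
    using fun_vs.basis_exists[of W] by metis
  have WB: "fun_vs.span B = W"
    using B(1,3) W(1) fun_vs.span_minimal by blast
  have indep: "fun_vs.independent (insert x B)"
    using x(2) B(2) by (intro fun_vs.independent_insertI) (auto simp: WB)
  define F where "F = pair.construct (insert x B) (\<lambda>b. if b = x then 1 else 0)"
  interpret F: Vector_Spaces.linear fun_scale "(*) :: 'a \<Rightarrow> 'a \<Rightarrow> 'a" F
    unfolding F_def by (rule pair.linear_construct[OF indep])
  have "F x = 1"
    unfolding F_def by (simp add: pair.construct_basis[OF indep])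
  have "F b = 0" if "b \<in> B" for b
    using that x(2) B(1) unfolding F_def by (subst pair.construct_basis[OF indep]) auto
  then have F0: "F y = 0" if "y \<in> W" for y
    using F.eq_0_on_span[of B y] that by (auto simp: WB)
  define f where "f = (\<lambda>i. F (\<lambda>j. if j = i then 1 else 0))"
  have F_eq: "F y = (\<Sum>i\<in>I. f i * y i)" if "y \<in> coord_space I" for y
  proof -
    have "y = (\<Sum>i\<in>I. fun_scale (y i) (\<lambda>j. if j = i then 1 else 0))"
      using that assms(1) by (auto simp: fun_eq_iff sum_fun_apply fun_scale_def coord_space_def
          if_distrib[of "\<lambda>z. _ * z"] cong: if_cong)
    then have "F y = F (\<Sum>i\<in>I. fun_scale (y i) (\<lambda>j. if j = i then 1 else 0))"
      by (rule arg_cong)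
    then show ?thesis by (simp add: F.sum F.scale f_def mult.commute)
  qed
  show thesis
  proof
    show "(\<Sum>i\<in>I. f i * y i) = 0" if "y \<in> W" for y
      using F0[OF that] F_eq[of y] that W(2) by auto
    show "(\<Sum>i\<in>I. f i * x i) \<noteq> 0"
      using \<open>F x = 1\<close> F_eq[OF x(1)] by auto
  qed
qed

text \<open>The coordinate \<open>p\<close> normalises both vectors, so along \<open>v + t u\<close>
  the variable at \<open>p\<close> is constantly 1. With \<open>u q\<close> nonzero this makes
  \<open>v\<close> and \<open>u\<close> independent, so the scheme really has degree two.\<close>

locale tangent_direction =
  fixes I :: "'i set" and v u :: "'i \<Rightarrow> 'a::field_char_0" and p q :: 'i
  assumes finite: "finite I" and p: "p \<in> I" "v p = 1" "u p = 0" and q: "q \<in> I" "u q \<noteq> 0"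
    and v: "v \<in> coord_space I" and u: "u \<in> coord_space I"
begin

abbreviation "Z \<equiv> double_point I v u"

lemma closed_subscheme: "closed_subscheme I Z"
  unfolding closed_subscheme_def
proof (intro conjI ballI allI impI ideal_double_point)
  show "hom_part t f \<in> Z" if "f \<in> Z" for f t
    using that by (intro double_point_iff_hom_part(1)) (auto simp: double_point_def)
next
  fix f assume f: "f \<in> polys I" "\<exists>k. \<forall>g\<in>forms I k. g * f \<in> Z"
  then obtain k where k: "\<And>g. g \<in> forms I k \<Longrightarrow> g * f \<in> Z" by blast
  \<comment> \<open>This power of the variable at \<open>p\<close> restricts to
    \<open>c ^ k\<close>, which can be cancelled for nonzero c.\<close>
  have "mvar p ^ k * f \<in> Z"
    by (intro k forms_power mvar_forms p(1))
  then have "[:0,0,1:] dvd smult (c ^ k) (mpoly_subst (\<lambda>i. smult c [:v i, u i:]) f)" for c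
    by (simp add: double_point_def mpoly_subst_mult mpoly_subst_power p poly_const_pow)
  then show "f \<in> Z"
    by (intro double_point_iff_hom_part(2) f(1)) (metis dvd_smult_cancel power_not_zero)
qed

text \<open>The constant coefficient of the restriction of \<open>f\<close> is the value of
  \<open>f\<close> at c v. If it vanishes, \<open>f\<close> restricts to a multiple of t and
  \<open>f ^ 2\<close> to a multiple of t^2; conversely, a scalar with a vanishing power is
  zero.\<close>

lemma radical: "radical_ideal I Z = vanishing_ideal I {fun_vs.span {v}}"
proof -
  have coeff0: "coeff (mpoly_subst (\<lambda>i. smult c [:v i, u i:]) f) 0 = mpoly_eval (fun_scale c v) f"
    for c f
    by (simp add: fun_scale_def poly_mpoly_subst flip: poly_0_coeff_0)
  have "f ^ 2 \<in> Z" if f: "f \<in> vanishing_ideal I {fun_vs.span {v}}" for f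
  proof -
    have "coeff (mpoly_subst (\<lambda>i. smult c [:v i, u i:]) f) 0 = 0" for c
      using f mem_span_singleton[of _ v] unfolding coeff0 vanishing_ideal_def by auto
    then have "[:0,0,1:] dvd mpoly_subst (\<lambda>i. smult c [:v i, u i:]) (f ^ 2)" for c
      unfolding cong_t2_iff mpoly_subst_power
      by (auto simp: power2_eq_square coeff_mult simp del: smult_pCons)
    then show ?thesis
      using f by (auto simp: vanishing_ideal_def double_point_def polys_power)
  qed
  moreover have "mpoly_eval (fun_scale c v) f = 0" if "f ^ k \<in> Z" for f k c
  proof -
    have "coeff (mpoly_subst (\<lambda>i. smult c [:v i, u i:]) (f ^ k)) 0 = 0"
      using that unfolding double_point_def cong_t2_iff by blast
    then show ?thesis
      by (simp add: coeff0 mpoly_subst_power coeff_0_power del: smult_pCons)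
  qed
  ultimately show ?thesis
    unfolding radical_ideal_def vanishing_ideal_def by (auto simp: mem_span_singleton)
qed

text \<open>Restriction to the line modulo the square of its parameter sends a form to two scalars,
  and the kernel consists of the forms in \<open>Z\<close>. The forms \<open>a\<close> and
  \<open>b\<close>, restricting to 1 and to a nonzero multiple of the parameter, show that the map
  is onto; \<open>b\<close> requires degree at least 1.\<close>

lemma hilbert_function:
  assumes "t \<ge> 1"
  shows "hilbert_function I Z t = 2"
proof -
  let ?E = "mpoly_subst (\<lambda>i. [:v i, u i:])"
  define a :: "('i, 'a) mpoly" where "a = mvar p ^ t"
  define b :: "('i, 'a) mpoly" where
    "b = mvar p ^ (t - 1) * (mvar q - Poly_Mapping.single (Poly_Mapping.single p 1) (v q))"
  have a: "a \<in> forms I t"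
    unfolding a_def by (intro forms_power mvar_forms p(1))
  have "b \<in> forms I (t - 1 + 1)"
    unfolding b_def
    by (intro forms_mult forms_power mpoly_vs.subspace_diff[OF subspace_forms] mvar_forms p(1) q(1))
  then have b: "b \<in> forms I t" using assms by simp
  have Ea: "?E a = 1"
    by (simp add: a_def mpoly_subst_power p pCons_one)
  have Eb: "?E b = [:0, u q:]"
    by (simp add: b_def mpoly_subst_power mpoly_subst_mult mpoly_subst_diff p pCons_one)
  have Z_iff: "f \<in> Z \<longleftrightarrow> coeff (?E f) 0 = 0 \<and> coeff (?E f) 1 = 0" if "f \<in> forms I t" for f
    using double_point_form_iff[OF that] cong_t2_iff by blast
  have "mpoly_vs.dim (forms I t :: ('i, 'a) mpoly set) = mpoly_vs.dim (Z \<inter> forms I t) + 2"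
  proof (rule mpoly_vs.dim_eq_dim_plus_2[where a = a and b = b])
    show "forms I t \<subseteq> mpoly_vs.span
     ((\<lambda>m. Poly_Mapping.single m 1) ` {m. Poly_Mapping.keys m \<subseteq> I \<and> mono_deg m = t})"
      by (rule forms_subset_span)
    show "finite ((\<lambda>m. Poly_Mapping.single m (1::'a)) `
        {m. Poly_Mapping.keys m \<subseteq> I \<and> mono_deg m = t})"
      by (intro finite_imageI finite_monomials finite)
    show "mpoly_vs.subspace (Z \<inter> forms I t)"
      by (intro mpoly_vs.subspace_inter subspace_double_point subspace_forms)
  next
    fix f :: "('i, 'a) mpoly" assume f: "f \<in> forms I t"
    let ?\<alpha> = "coeff (?E f) 0" and ?\<beta> = "coeff (?E f) 1 / u q"
    have "f - mpoly_scale ?\<alpha> a - mpoly_scale ?\<beta> b \<in> forms I t"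
      by (intro mpoly_vs.subspace_diff mpoly_vs.subspace_scale subspace_forms a b f)
    moreover from this have "f - mpoly_scale ?\<alpha> a - mpoly_scale ?\<beta> b \<in> Z"
      using q(2) by (simp add: Z_iff mpoly_subst_diff mpoly_subst_scale Ea Eb)
    ultimately show "\<exists>\<alpha> \<beta>. f - mpoly_scale \<alpha> a - mpoly_scale \<beta> b \<in> Z \<inter> forms I t"
      by blast
  next
    fix \<alpha> \<beta> assume "mpoly_scale \<alpha> a + mpoly_scale \<beta> b \<in> Z \<inter> forms I t"
    then have "coeff (?E (mpoly_scale \<alpha> a + mpoly_scale \<beta> b)) 0 = 0"
      "coeff (?E (mpoly_scale \<alpha> a + mpoly_scale \<beta> b)) 1 = 0"
      using Z_iff by blast+
    then show "\<alpha> = 0 \<and> \<beta> = 0"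
      using q(2) by (simp add: mpoly_subst_add mpoly_subst_scale Ea Eb)
  qed (use a b in auto)
  then show ?thesis by (simp add: hilbert_function_def)
qed

lemma zero_dim_of_degree_2: "zero_dim_of_degree I Z 2"
  unfolding zero_dim_of_degree_def using hilbert_function by auto

text \<open>A linear subspace containing the scheme has its linear equations in \<open>Z\<close>.
  Second-order vanishing makes them kill both \<open>v\<close> and \<open>u\<close>, and separating
  functionals then place both vectors in the subspace.\<close>

lemma mem_scheme_span:
  assumes x: "x \<in> fun_vs.span {v, u}" "x \<noteq> 0"
  shows "fun_vs.span {x} \<in> scheme_span I Z"
  unfolding scheme_span_def
proof (intro InterI, clarify)
  fix L assume "linear_subspace I L" and L: "vanishing_ideal I L \<subseteq> Z"
  then obtain W where W: "fun_vs.subspace W" "W \<subseteq> coord_space I" "L = proj W"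
    unfolding linear_subspace_def by blast
  have *: "(\<Sum>i\<in>I. f i * v i) = 0 \<and> (\<Sum>i\<in>I. f i * u i) = 0"
    if f: "\<And>y. y \<in> W \<Longrightarrow> (\<Sum>i\<in>I. f i * y i) = 0" for f
  proof -
    define l :: "('i, 'a) mpoly" where "l = (\<Sum>i\<in>I. Poly_Mapping.single (Poly_Mapping.single i 1) (f i))"
    have l: "l \<in> forms I 1"
      unfolding l_def by (intro mpoly_vs.subspace_sum[OF subspace_forms] mvar_forms)
    have "mpoly_eval y l = (\<Sum>i\<in>I. f i * y i)" for y
      by (simp add: mpoly_eval_conv_subst l_def mpoly_subst_sum poly_sum)
    moreover have "y \<in> W" if "P \<in> L" "y \<in> P" for P y
      using that W(1) by (auto simp: W(3) proj_def mem_span_singleton fun_vs.subspace_scale)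
    ultimately have "l \<in> vanishing_ideal I L"
      using f l by (auto simp: vanishing_ideal_def forms_def)
    then have "l \<in> Z" using L by blast
    then show ?thesis
      unfolding double_point_form_iff[OF l] cong_t2_iff
      by (simp add: l_def mpoly_subst_sum coeff_sum)
  qed
  have "v \<in> W"
    using separating_functional[OF finite W(1,2) v] * by metis
  moreover have "u \<in> W"
    using separating_functional[OF finite W(1,2) u] * by metis
  ultimately have "x \<in> W"
    using x(1) fun_vs.span_minimal[of "{v, u}" W] W(1) by blast
  then show "fun_vs.span {x} \<in> L"
    using x(2) by (auto simp: W(3) proj_def)
qed

text \<open>A polynomial vanishing on \<open>proj W\<close> vanishes at all multiples of
  \<open>v + t u\<close>, so it restricts to zero; hence \<open>proj W\<close> is one of the
  subspaces being intersected.\<close>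

lemma scheme_span_subset:
  assumes W: "fun_vs.subspace W" "W \<subseteq> coord_space I" "v \<in> W" "u \<in> W"
  shows "scheme_span I Z \<subseteq> proj W"
proof -
  have "[:0,0,1:] dvd mpoly_subst (\<lambda>i. smult c [:v i, u i:]) f"
    if f: "f \<in> vanishing_ideal I (proj W)" for f c
  proof -
    have "poly (mpoly_subst (\<lambda>i. smult c [:v i, u i:]) f) t = 0" for t
    proof -
      define y where "y = v + fun_scale t u"
      have "y \<in> W"
        unfolding y_def using W by (intro fun_vs.subspace_add fun_vs.subspace_scale)
      moreover have "y p = 1" by (simp add: y_def fun_scale_def p)
      then have "y \<noteq> 0" by auto
      ultimately have "fun_vs.span {y} \<in> proj W" by (auto simp: proj_def)
      moreover have "fun_scale c y \<in> fun_vs.span {y}" by (auto simp: mem_span_singleton)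
      ultimately have "mpoly_eval (fun_scale c y) f = 0"
        using f unfolding vanishing_ideal_def by blast
      then show ?thesis
        by (simp add: poly_mpoly_subst y_def fun_scale_def algebra_simps)
    qed
    then have "mpoly_subst (\<lambda>i. smult c [:v i, u i:]) f = 0"
      using poly_all_0_iff_0 by blast
    then show ?thesis by simp
  qed
  then have "vanishing_ideal I (proj W) \<subseteq> Z"
    by (auto simp: vanishing_ideal_def double_point_def)
  then show ?thesis
    using W unfolding scheme_span_def linear_subspace_def by blast
qed

end

section \<open>Points of the Segre variety\<close>

lemma span_fun_scale: "c \<noteq> 0 \<Longrightarrow> fun_vs.span {fun_scale c v} = fun_vs.span {v}"
  using fun_vs.span_image_scale[of "{v}" "\<lambda>_. c"] by simp

lemma fun_scale_mem_coord_space: "v \<in> coord_space I \<Longrightarrow> fun_scale c v \<in> coord_space I"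
  by (simp add: coord_space_def fun_scale_def)

lemma subspace_coord_space: "fun_vs.subspace (coord_space I)"
  by (rule fun_vs.subspaceI) (auto simp: coord_space_def fun_scale_def)

lemma finite_multi_idx: "finite (multi_idx d n)"
  by (simp add: multi_idx_def finite_PiE)

lemma multi_idx_update:
  "a \<in> multi_idx d n \<Longrightarrow> i \<in> {1..d} \<Longrightarrow> b \<le> n i \<Longrightarrow> a(i := b) \<in> multi_idx d n"
  by (auto simp: multi_idx_def PiE_iff extensional_def)

lemma multi_idx_le: "a \<in> multi_idx d n \<Longrightarrow> i \<in> {1..d} \<Longrightarrow> a i \<le> n i"
  by (auto simp: multi_idx_def PiE_iff)

lemma pure_tensor_coord_space: "pure_tensor d n v \<in> coord_space (multi_idx d n)"
  by (simp add: coord_space_def pure_tensor_def)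

lemma pure_tensor_cong: "(\<And>i. i \<in> {1..d} \<Longrightarrow> v i = v' i) \<Longrightarrow> pure_tensor d n v = pure_tensor d n v'"
  by (auto simp: pure_tensor_def fun_eq_iff intro!: prod.cong)

lemma pure_tensor_scale:
  "pure_tensor d n (\<lambda>i. fun_scale (c i) (v i)) = fun_scale (\<Prod>i\<in>{1..d}. c i) (pure_tensor d n v)"
  by (auto simp: pure_tensor_def fun_scale_def fun_eq_iff prod.distrib)

lemma pure_tensor_remove:
  assumes "a \<in> multi_idx d n" "i \<in> {1..d}"
  shows "pure_tensor d n v a = v i (a i) * (\<Prod>j\<in>{1..d} - {i}. v j (a j))"
  using assms by (simp add: pure_tensor_def prod.remove)

lemma pure_tensor_update:
  assumes "a \<in> multi_idx d n" "i \<in> {1..d}"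
  shows "pure_tensor d n (v(i := y)) a = y (a i) * (\<Prod>j\<in>{1..d} - {i}. v j (a j))"
  using assms by (simp add: pure_tensor_remove[OF assms])

lemma pure_tensor_update_scale:
  assumes "i \<in> {1..d}"
  shows "pure_tensor d n (v(i := fun_scale c y)) = fun_scale c (pure_tensor d n (v(i := y)))"
proof
  fix a show "pure_tensor d n (v(i := fun_scale c y)) a = fun_scale c (pure_tensor d n (v(i := y))) a"
    using pure_tensor_update[of a d n i v] assms
    by (cases "a \<in> multi_idx d n") (auto simp: fun_scale_def pure_tensor_def)
qed

lemma pure_tensor_update_add:
  assumes "i \<in> {1..d}"
  shows "pure_tensor d n (v(i := y + z)) = pure_tensor d n (v(i := y)) + pure_tensor d n (v(i := z))"
proof
  fix a show "pure_tensor d n (v(i := y + z)) a =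
      (pure_tensor d n (v(i := y)) + pure_tensor d n (v(i := z))) a"
  proof (cases "a \<in> multi_idx d n")
    case True
    then show ?thesis
      by (simp add: pure_tensor_update[OF True assms] distrib_right del: fun_upd_apply)
  qed (simp add: pure_tensor_def)
qed

lemma pure_tensor_update_0:
  assumes "i \<in> {1..d}"
  shows "pure_tensor d n (v(i := 0)) = 0"
  using pure_tensor_update_add[OF assms, of n v 0 0] by simp

text \<open>Rescaling the factors only rescales the tensor, so any vectors spanning the factors give
  the same line.\<close>

lemma segre_eq:
  assumes "\<And>i. i \<in> {1..d} \<Longrightarrow> Q i = fun_vs.span {v i}"
  shows "segre d n Q = fun_vs.span {pure_tensor d n v}"
proof -
  have "pure_tensor d n x \<in> fun_vs.span {pure_tensor d n v}" if "\<forall>i\<in>{1..d}. x i \<in> Q i" for x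
  proof -
    have "\<forall>i\<in>{1..d}. \<exists>c. x i = fun_scale c (v i)"
      using that assms by (auto simp: mem_span_singleton)
    then obtain c where "\<forall>i\<in>{1..d}. x i = fun_scale (c i) (v i)" by metis
    then have "pure_tensor d n x = pure_tensor d n (\<lambda>i. fun_scale (c i) (v i))"
      by (intro pure_tensor_cong) auto
    then show ?thesis by (auto simp: pure_tensor_scale mem_span_singleton)
  qed
  then have "segre d n Q \<subseteq> fun_vs.span {pure_tensor d n v}"
    unfolding segre_def by (intro fun_vs.span_minimal) auto
  moreover have "v i \<in> Q i" if "i \<in> {1..d}" for i
    using assms[OF that] fun_vs.span_base by blast
  then have "fun_vs.span {pure_tensor d n v} \<subseteq> segre d n Q"
    unfolding segre_def by (intro fun_vs.span_mono) blast
  ultimately show ?thesis by blast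
qed

lemma segre_variety_iff:
  "P \<in> segre_variety d n \<longleftrightarrow>
     (\<exists>v. (\<forall>i\<in>{1..d}. v i \<in> coord_space {0..n i} \<and> v i \<noteq> 0) \<and> P = fun_vs.span {pure_tensor d n v})"
  (is "?l \<longleftrightarrow> ?r")
proof
  assume ?l
  then obtain Q where Q: "Q \<in> multi_proj d n" "P = segre d n Q"
    by (auto simp: segre_variety_def)
  then have "\<forall>i\<in>{1..d}. \<exists>v. v \<in> coord_space {0..n i} \<and> v \<noteq> 0 \<and> Q i = fun_vs.span {v}"
    by (auto simp: multi_proj_def PiE_iff proj_space_def proj_def)
  then obtain v where "\<forall>i\<in>{1..d}. v i \<in> coord_space {0..n i} \<and> v i \<noteq> 0 \<and> Q i = fun_vs.span {v i}"
    by metis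
  then show ?r using Q(2) segre_eq[of d Q v n] by blast
next
  assume ?r
  then obtain v where v: "\<forall>i\<in>{1..d}. v i \<in> coord_space {0..n i} \<and> v i \<noteq> 0"
    "P = fun_vs.span {pure_tensor d n v}" by blast
  define Q where "Q = (\<lambda>i\<in>{1..d}. fun_vs.span {v i})"
  have "Q \<in> multi_proj d n"
    using v(1) by (auto simp: Q_def multi_proj_def proj_space_def proj_def)
  moreover have "segre d n Q = P"
    unfolding v(2) by (rule segre_eq) (simp add: Q_def)
  ultimately show ?l by (auto simp: segre_variety_def)
qed

text \<open>Representatives are normalised to have coordinate 1 at a chosen index
  \<open>r i\<close>. The tensor then has coordinate 1 at \<open>r\<close>, and its coordinates at
  \<open>r(i := b)\<close> are those of \<open>v i\<close>.\<close>

locale segre_point =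
  fixes d :: nat and n :: "nat \<Rightarrow> nat" and v :: "nat \<Rightarrow> nat \<Rightarrow> 'a::field_char_0" and r :: "nat \<Rightarrow> nat"
  assumes v: "\<And>i. i \<in> {1..d} \<Longrightarrow> v i \<in> coord_space {0..n i}"
    and r: "r \<in> multi_idx d n"
    and v_r: "\<And>i. i \<in> {1..d} \<Longrightarrow> v i (r i) = 1"

lemma segre_variety_obtain:
  assumes "P \<in> segre_variety d n"
  obtains v r where "segre_point d n v r" "P = fun_vs.span {pure_tensor d n v}"
proof -
  obtain y where y: "\<And>i. i \<in> {1..d} \<Longrightarrow> y i \<in> coord_space {0..n i}"
    "\<And>i. i \<in> {1..d} \<Longrightarrow> y i \<noteq> 0" "P = fun_vs.span {pure_tensor d n y}"
    using assms unfolding segre_variety_iff by metis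
  have "\<forall>i\<in>{1..d}. \<exists>b. y i b \<noteq> 0"
    using y(2) by (auto simp: fun_eq_iff)
  then obtain s where s: "\<forall>i\<in>{1..d}. y i (s i) \<noteq> 0" by metis
  define r where "r = restrict s {1..d}"
  define v where "v = (\<lambda>i. fun_scale (1 / y i (s i)) (y i))"
  have "segre_point d n v r"
  proof
    show "r \<in> multi_idx d n"
      using s y(1) unfolding r_def multi_idx_def coord_space_def by force
  qed (use s y(1) in \<open>auto simp: v_def r_def fun_scale_mem_coord_space fun_scale_def coord_space_def\<close>)
  moreover have "fun_vs.span {v i} = fun_vs.span {y i}" if "i \<in> {1..d}" for i
    unfolding v_def using s that by (intro span_fun_scale) auto
  then have "fun_vs.span {pure_tensor d n v} = P"
    unfolding y(3) using segre_eq[of d "\<lambda>i. fun_vs.span {y i}" v n]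
      segre_eq[of d "\<lambda>i. fun_vs.span {y i}" y n] by simp
  ultimately show thesis using that by blast
qed

text \<open>The product rule at t = 0; it computes the derivative of the tensor product of the
  vectors \<open>v i + t W i\<close>, coordinate by coordinate.\<close>

lemma coeff_prod_linear:
  fixes f g :: "'b \<Rightarrow> 'a::field"
  assumes "finite A"
  shows "coeff (\<Prod>i\<in>A. [:f i, g i:]) 0 = (\<Prod>i\<in>A. f i)"
    and "coeff (\<Prod>i\<in>A. [:f i, g i:]) 1 = (\<Sum>i\<in>A. g i * (\<Prod>j\<in>A - {i}. f j))"
proof -
  show "coeff (\<Prod>i\<in>A. [:f i, g i:]) 0 = (\<Prod>i\<in>A. f i)"
    using assms by induction (auto simp: coeff_mult)
  show "coeff (\<Prod>i\<in>A. [:f i, g i:]) 1 = (\<Sum>i\<in>A. g i * (\<Prod>j\<in>A - {i}. f j))"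
    using assms
  proof induction
    case (insert k A)
    have "(\<Prod>j\<in>insert k A - {i}. f j) = f k * (\<Prod>j\<in>A - {i}. f j)" if "i \<in> A" for i
    proof -
      have "insert k A - {i} = insert k (A - {i})" using that insert.hyps by auto
      then show ?thesis using insert.hyps by simp
    qed
    moreover have "coeff (\<Prod>i\<in>A. [:f i, g i:]) 0 = (\<Prod>i\<in>A. f i)"
      using insert.hyps(1) by induction (auto simp: coeff_mult)
    ultimately show ?case
      using insert by (simp add: sum_distrib_left algebra_simps)
  qed auto
qed

context segre_point
begin

abbreviation "I \<equiv> multi_idx d n"
abbreviation "X \<equiv> segre_variety d n :: ((nat \<Rightarrow> nat) \<Rightarrow> 'a) set set"
abbreviation "T \<equiv> pure_tensor d n v"

lemma r_le: "i \<in> {1..d} \<Longrightarrow> r i \<le> n i"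
  using r by (rule multi_idx_le)

lemma T_r: "T r = 1"
  using r v_r by (simp add: pure_tensor_def)

lemma v_nonzero: "i \<in> {1..d} \<Longrightarrow> v i \<noteq> 0"
  using v_r by fastforce

lemma span_T_mem_X: "fun_vs.span {T} \<in> X"
  unfolding segre_variety_iff using v v_nonzero by blast

lemma pure_tensor_at_r_update:
  assumes "i \<in> {1..d}" "b \<le> n i"
  shows "pure_tensor d n x (r(i := b)) = x i b * (\<Prod>j\<in>{1..d} - {i}. x j (r j))"
  using pure_tensor_remove[OF multi_idx_update[OF r assms] assms(1), of x] by simp

text \<open>Injectivity of the Segre map: comparing coordinates along the i-th slice through
  \<open>r\<close> shows that \<open>v i\<close> is a multiple of the given representative of
  \<open>Q i\<close>.\<close>

lemma segre_factors_unique: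
  assumes "Q \<in> multi_proj d n" "segre d n Q = fun_vs.span {T}" "i \<in> {1..d}"
  shows "Q i = fun_vs.span {v i}"
proof -
  have "\<forall>i\<in>{1..d}. \<exists>y. y \<in> coord_space {0..n i} \<and> Q i = fun_vs.span {y}"
    using assms(1) by (auto simp: multi_proj_def PiE_iff proj_space_def proj_def)
  then obtain y where y: "\<forall>i\<in>{1..d}. y i \<in> coord_space {0..n i} \<and> Q i = fun_vs.span {y i}"
    by metis
  have "T \<in> fun_vs.span {pure_tensor d n y}"
    using segre_eq[of d Q y n] y assms(2) fun_vs.span_base by blast
  then obtain c where c: "T = fun_scale c (pure_tensor d n y)"
    by (auto simp: mem_span_singleton)
  define k where "k = c * (\<Prod>j\<in>{1..d} - {i}. y j (r j))"
  have "v i b = k * y i b" for b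
  proof (cases "b \<le> n i")
    case True
    have "T (r(i := b)) = c * pure_tensor d n y (r(i := b))"
      by (subst c) (simp add: fun_scale_def)
    then show ?thesis
      unfolding pure_tensor_at_r_update[OF assms(3) True] by (simp add: k_def v_r)
  next
    case False
    then show ?thesis using y v assms(3) by (auto simp: coord_space_def)
  qed
  then have "v i = fun_scale k (y i)" by (auto simp: fun_scale_def)
  moreover from this have "k \<noteq> 0"
    using v_nonzero[OF assms(3)] by (auto simp: fun_scale_def)
  ultimately show ?thesis
    using y assms(3) span_fun_scale[of k "y i"] by auto
qed

lemma Union_factor_space:
  assumes i: "i \<in> {1..d}"
  shows "\<Union> (factor_space d n (fun_vs.span {T}) i) = {pure_tensor d n (v(i := y)) |y. y \<in> coord_space {0..n i}}"
proof (intro equalityI subsetI)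
  fix x assume "x \<in> \<Union> (factor_space d n (fun_vs.span {T}) i)"
  then obtain Q S where Q: "Q \<in> multi_proj d n" "segre d n Q = fun_vs.span {T}"
    "S \<in> proj_space {0..n i}" "x \<in> segre d n (Q(i := S))"
    unfolding factor_space_def by blast
  obtain y where y: "y \<in> coord_space {0..n i}" "S = fun_vs.span {y}"
    using Q(3) by (auto simp: proj_space_def proj_def)
  have "segre d n (Q(i := S)) = fun_vs.span {pure_tensor d n (v(i := y))}"
    using segre_factors_unique[OF Q(1,2)] y(2) by (intro segre_eq) auto
  then obtain c where "x = fun_scale c (pure_tensor d n (v(i := y)))"
    using Q(4) by (auto simp: mem_span_singleton)
  then have "x = pure_tensor d n (v(i := fun_scale c y))"
    by (simp add: pure_tensor_update_scale[OF i])
  then show "x \<in> {pure_tensor d n (v(i := y)) |y. y \<in> coord_space {0..n i}}"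
    using fun_scale_mem_coord_space[OF y(1)] by blast
next
  fix x assume "x \<in> {pure_tensor d n (v(i := y)) |y. y \<in> coord_space {0..n i}}"
  then obtain y where y: "y \<in> coord_space {0..n i}" "x = pure_tensor d n (v(i := y))" by blast
  \<comment> \<open>A projective factor needs a nonzero vector, so for \<open>y = 0\<close> the zero
    tensor is reached as a zero multiple, with \<open>v i\<close> standing in.\<close>
  define z where "z = (if y = 0 then v i else y)"
  obtain c where c: "y = fun_scale c z"
  proof
    show "y = fun_scale (if y = 0 then 0 else 1) z"
      by (auto simp: z_def fun_scale_def)
  qed
  have z: "z \<in> coord_space {0..n i}" "z \<noteq> 0"
    using y v[OF i] v_nonzero[OF i] by (auto simp: z_def)
  define Q where "Q = (\<lambda>i\<in>{1..d}. fun_vs.span {v i})"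
  have "Q \<in> multi_proj d n"
    using v v_nonzero by (fastforce simp: Q_def multi_proj_def proj_space_def proj_def)
  moreover have "segre d n Q = fun_vs.span {T}"
    by (rule segre_eq) (simp add: Q_def)
  moreover have "segre d n (Q(i := fun_vs.span {z})) = fun_vs.span {pure_tensor d n (v(i := z))}"
    by (rule segre_eq) (simp add: Q_def)
  moreover have "fun_vs.span {z} \<in> proj_space {0..n i}"
    using z by (auto simp: proj_space_def proj_def)
  moreover have "x \<in> fun_vs.span {pure_tensor d n (v(i := z))}"
    by (simp add: y(2) c pure_tensor_update_scale[OF i] fun_vs.span_scale fun_vs.span_base)
  ultimately show "x \<in> \<Union> (factor_space d n (fun_vs.span {T}) i)"
    unfolding factor_space_def by blast
qed

text \<open>By linearity in slot i, tensors from the same factor space add up to a single one. Hence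
  the sums with one term per index already form a subspace containing all the factor spaces.\<close>

lemma span_factor_spaces:
  assumes E: "E \<subseteq> {1..d}" and x: "x \<in> fun_vs.span (\<Union> (\<Union>i\<in>E. factor_space d n (fun_vs.span {T}) i))"
  obtains y where "\<And>i. i \<in> E \<Longrightarrow> y i \<in> coord_space {0..n i}"
    "x = (\<Sum>i\<in>E. pure_tensor d n (v(i := y i)))"
proof -
  define S where
    "S = {\<Sum>i\<in>E. pure_tensor d n (v(i := y i)) |y. \<forall>i\<in>E. y i \<in> coord_space {0..n i}}"
  have coord: "fun_vs.subspace (coord_space {0..n i} :: (nat \<Rightarrow> 'a) set)" for i
    by (rule subspace_coord_space)
  have "finite E" using E finite_subset by blast
  have "\<Union> (\<Union>i\<in>E. factor_space d n (fun_vs.span {T}) i) \<subseteq> S"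
  proof
    fix z assume "z \<in> \<Union> (\<Union>i\<in>E. factor_space d n (fun_vs.span {T}) i)"
    then obtain i where i: "i \<in> E" "z \<in> \<Union> (factor_space d n (fun_vs.span {T}) i)" by blast
    then obtain y where y: "y \<in> coord_space {0..n i}" "z = pure_tensor d n (v(i := y))"
      using Union_factor_space[of i] E by blast
    let ?y = "\<lambda>j. if j = i then y else 0"
    have "pure_tensor d n (v(j := ?y j)) = (if j = i then z else 0)" if "j \<in> E" for j
      using that E y(2) pure_tensor_update_0[of j d n v] by auto
    then have "(\<Sum>j\<in>E. pure_tensor d n (v(j := ?y j))) = z"
      using i(1) \<open>finite E\<close> by simp
    then show "z \<in> S"
      unfolding S_def using y(1) fun_vs.subspace_0[OF coord] by (auto intro!: exI[of _ ?y])
  qed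
  moreover have "fun_vs.subspace S"
  proof (rule fun_vs.subspaceI)
    have "(\<Sum>j\<in>E. pure_tensor d n (v(j := 0))) = 0"
      using E pure_tensor_update_0[of _ d n v] by (auto intro!: sum.neutral)
    then show "0 \<in> S"
      unfolding S_def using fun_vs.subspace_0[OF coord] by (auto intro!: exI[of _ "\<lambda>_. 0"])
  next
    fix x y assume "x \<in> S" "y \<in> S"
    then obtain x' y' where xy:
      "x = (\<Sum>i\<in>E. pure_tensor d n (v(i := x' i)))" "\<forall>i\<in>E. x' i \<in> coord_space {0..n i}"
      "y = (\<Sum>i\<in>E. pure_tensor d n (v(i := y' i)))" "\<forall>i\<in>E. y' i \<in> coord_space {0..n i}"
      unfolding S_def by blast
    have "x + y = (\<Sum>i\<in>E. pure_tensor d n (v(i := x' i + y' i)))"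
      unfolding xy sum.distrib[symmetric] using E
      by (intro sum.cong refl pure_tensor_update_add[symmetric]) auto
    then show "x + y \<in> S"
      unfolding S_def using xy(2,4) fun_vs.subspace_add[OF coord]
      by (auto intro!: exI[of _ "\<lambda>i. x' i + y' i"])
  next
    fix c x assume "x \<in> S"
    then obtain x' where x:
      "x = (\<Sum>i\<in>E. pure_tensor d n (v(i := x' i)))" "\<forall>i\<in>E. x' i \<in> coord_space {0..n i}"
      unfolding S_def by blast
    have "fun_scale c x = (\<Sum>i\<in>E. pure_tensor d n (v(i := fun_scale c (x' i))))"
      unfolding x fun_vs.scale_sum_right using E
      by (intro sum.cong refl pure_tensor_update_scale[symmetric]) auto
    then show "fun_scale c x \<in> S"
      unfolding S_def using x(2) fun_vs.subspace_scale[OF coord]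
      by (auto intro!: exI[of _ "\<lambda>i. fun_scale c (x' i)"])
  qed
  ultimately have "x \<in> S"
    using x fun_vs.span_minimal by blast
  then show thesis using that unfolding S_def by blast
qed

text \<open>Each term with \<open>y i\<close> nonzero gives a point of \<open>X\<close>. The other
  terms are zero and define no point; coinciding points only lower the cardinality.\<close>

lemma sum_updates_mem_lin_span:
  assumes E: "E \<subseteq> {1..d}" and y: "\<And>i. i \<in> E \<Longrightarrow> y i \<in> coord_space {0..n i}"
    and x: "x = (\<Sum>i\<in>E. pure_tensor d n (v(i := y i)))" "x \<noteq> 0"
  obtains S where "finite S" "S \<subseteq> X" "card S \<le> card E" "fun_vs.span {x} \<in> lin_span S"
proof
  let ?f = "\<lambda>i. fun_vs.span {pure_tensor d n (v(i := y i))}"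
  let ?E = "{i \<in> E. y i \<noteq> 0}"
  have "finite E" using E finite_subset by blast
  then show "finite (?f ` ?E)" by simp
  show "card (?f ` ?E) \<le> card E"
    using \<open>finite E\<close> by (intro order.trans[OF card_image_le card_mono]) auto
  show "?f ` ?E \<subseteq> X"
  proof clarify
    fix i assume "i \<in> E" "y i \<noteq> 0"
    then show "?f i \<in> X"
      unfolding segre_variety_iff using E y v v_nonzero by (intro exI[of _ "v(i := y i)"]) auto
  qed
  have "pure_tensor d n (v(i := y i)) \<in> fun_vs.span (\<Union> (?f ` ?E))" if "i \<in> E" for i
  proof (cases "y i = 0")
    case True
    then have "pure_tensor d n (v(i := y i)) = 0"
      using pure_tensor_update_0[of i d n v] E that by auto
    then show ?thesis by (simp add: fun_vs.span_zero)
  next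
    case False
    then show ?thesis
      using that fun_vs.span_base[of "pure_tensor d n (v(i := y i))" "{pure_tensor d n (v(i := y i))}"]
      by (intro fun_vs.span_base) blast
  qed
  then have "x \<in> fun_vs.span (\<Union> (?f ` ?E))"
    unfolding x by (intro fun_vs.span_sum)
  then show "fun_vs.span {x} \<in> lin_span (?f ` ?E)"
    using x(2) by (auto simp: lin_span_def proj_def)
qed

end

section \<open>Tangent vectors of the Segre variety\<close>

text \<open>Adding a multiple of \<open>v i\<close> to \<open>W i\<close> changes the tangent vector
  by a multiple of \<open>T\<close> only. Coordinate 0 at \<open>r i\<close> fixes this freedom, so
  a nonzero \<open>W i\<close> is independent of \<open>v i\<close>.\<close>

locale segre_tangent = segre_point +
  fixes W :: "nat \<Rightarrow> nat \<Rightarrow> 'a"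
  assumes W: "\<And>i. i \<in> {1..d} \<Longrightarrow> W i \<in> coord_space {0..n i}"
    and W_r: "\<And>i. i \<in> {1..d} \<Longrightarrow> W i (r i) = 0"
begin

text \<open>The derivative at t = 0 of the tensor product of the vectors
  \<open>v i + t W i\<close>.\<close>

definition U :: "(nat \<Rightarrow> nat) \<Rightarrow> 'a" where
  "U = (\<Sum>i\<in>{1..d}. pure_tensor d n (v(i := W i)))"

definition support :: "nat set" where
  "support = {i \<in> {1..d}. W i \<noteq> 0}"

lemma support_subset: "support \<subseteq> {1..d}"
  by (auto simp: support_def)

lemma U_support: "U = (\<Sum>i\<in>support. pure_tensor d n (v(i := W i)))"
  unfolding U_def support_def
  by (rule sum.mono_neutral_right) (auto simp: pure_tensor_update_0)

lemma U_apply: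
  assumes "a \<in> I"
  shows "U a = (\<Sum>i\<in>{1..d}. W i (a i) * (\<Prod>j\<in>{1..d} - {i}. v j (a j)))"
  unfolding U_def sum_fun_apply by (intro sum.cong refl pure_tensor_update assms)

lemma U_coord_space: "U \<in> coord_space I"
  unfolding U_def by (intro fun_vs.subspace_sum[OF subspace_coord_space] pure_tensor_coord_space)

text \<open>The curve of tensor products of the \<open>v i + t W i\<close> stays on the Segre
  variety and agrees with \<open>T + t U\<close> modulo t^2. A polynomial vanishing on the variety
  is zero along the former, hence vanishes to second order along the latter.\<close>

lemma vanishing_ideal_subset: "vanishing_ideal I X \<subseteq> double_point I T U"
proof
  fix f assume f: "f \<in> vanishing_ideal I X"
  define \<phi> where "\<phi> = (\<lambda>a. if a \<in> I then \<Prod>i\<in>{1..d}. [:v i (a i), W i (a i):] else 0)"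
  have dvd: "[:0,0,1:] dvd [:T a, U a:] - \<phi> a" for a
  proof (cases "a \<in> I")
    case True
    then show ?thesis
      unfolding cong_t2_iff
      using coeff_prod_linear[of "{1..d}" "\<lambda>i. v i (a i)" "\<lambda>i. W i (a i)"]
      by (simp add: \<phi>_def U_apply pure_tensor_def)
  next
    case False
    then show ?thesis
      using U_coord_space by (simp add: \<phi>_def pure_tensor_def coord_space_def)
  qed
  have "[:0,0,1:] dvd mpoly_subst (\<lambda>a. smult c [:T a, U a:]) f" for c
  proof -
    have "poly (mpoly_subst (\<lambda>a. smult c (\<phi> a)) f) t = 0" for t
    proof -
      let ?y = "\<lambda>i. v i + fun_scale t (W i)"
      have y: "?y i \<in> coord_space {0..n i} \<and> ?y i \<noteq> 0" if "i \<in> {1..d}" for i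
      proof
        show "?y i \<in> coord_space {0..n i}"
          using v[OF that] W[OF that] by (simp add: coord_space_def fun_scale_def)
        \<comment> \<open>The normalisation at \<open>r i\<close> keeps every factor nonzero for all
          t.\<close>
        have "(v i + fun_scale t (W i)) (r i) = 1"
          using v_r[OF that] W_r[OF that] by (simp add: fun_scale_def)
        then show "?y i \<noteq> 0" by (metis zero_fun_apply zero_neq_one)
      qed
      have "fun_vs.span {pure_tensor d n ?y} \<in> X"
        unfolding segre_variety_iff by (intro exI[of _ ?y] conjI[OF _ refl] ballI y)
      moreover have "fun_scale c (pure_tensor d n ?y) \<in> fun_vs.span {pure_tensor d n ?y}"
        by (auto simp: mem_span_singleton)
      ultimately have "mpoly_eval (fun_scale c (pure_tensor d n ?y)) f = 0"
        using f unfolding vanishing_ideal_def by blast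
      moreover have "(\<lambda>a. poly (smult c (\<phi> a)) t) = fun_scale c (pure_tensor d n ?y)"
        by (auto simp: \<phi>_def pure_tensor_def fun_scale_def poly_prod fun_eq_iff)
      ultimately show ?thesis by (simp add: poly_mpoly_subst)
    qed
    then have "mpoly_subst (\<lambda>a. smult c (\<phi> a)) f = 0"
      using poly_all_0_iff_0 by blast
    moreover have "[:0,0,1:] dvd
        mpoly_subst (\<lambda>a. smult c [:T a, U a:]) f - mpoly_subst (\<lambda>a. smult c (\<phi> a)) f"
      by (intro dvd_diff_mpoly_subst) (metis dvd dvd_smult smult_diff_right)
    ultimately show ?thesis by simp
  qed
  then show "f \<in> double_point I T U"
    using f unfolding vanishing_ideal_def double_point_def by blast
qed

text \<open>The normalising coordinate is \<open>r\<close>, where every summand of \<open>U\<close>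
  vanishes. At an index \<open>q\<close> that differs from \<open>r\<close> only in a slot with
  \<open>W i\<close> nonzero, exactly that summand survives.\<close>

lemma tangent_direction:
  assumes "support \<noteq> {}"
  obtains q where "tangent_direction I T U r q"
proof -
  obtain i b where i: "i \<in> {1..d}" "W i b \<noteq> 0"
    using assms by (auto simp: support_def fun_eq_iff)
  have b: "b \<le> n i"
    using i W[OF i(1)] by (auto simp: coord_space_def)
  have q: "r(i := b) \<in> I"
    by (rule multi_idx_update[OF r i(1) b])
  have "U (r(i := b)) = (\<Sum>k\<in>{1..d}. if k = i then W i b else 0)"
    unfolding U_apply[OF q] by (intro sum.cong) (auto simp: W_r v_r)
  then have "U (r(i := b)) \<noteq> 0" using i by simp
  moreover have "U r = 0"
    unfolding U_apply[OF r] by (intro sum.neutral) (auto simp: W_r)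
  ultimately have "tangent_direction I T U r (r(i := b))"
    by (intro tangent_direction.intro finite_multi_idx r T_r q U_coord_space pure_tensor_coord_space)
  then show thesis by (rule that)
qed

lemma tangent_vector:
  assumes "support \<noteq> {}"
  shows "(fun_vs.span {T}, double_point I T U) \<in> tangent_vectors d n"
proof -
  obtain q where "tangent_direction I T U r q"
    by (rule tangent_direction[OF assms])
  then interpret dir: tangent_direction I T U r q .
  show ?thesis
    using span_T_mem_X dir.closed_subscheme vanishing_ideal_subset dir.radical dir.zero_dim_of_degree_2
    by (simp add: tangent_vectors_def)
qed

text \<open>\<open>T\<close> lies in every factor space at its own point, and the i-th summand of
  \<open>U\<close> in the i-th one. Nonempty support provides a factor space for
  \<open>T\<close>.\<close>

lemma scheme_span_factor_spaces:
  assumes "support \<noteq> {}"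
  shows "scheme_span I (double_point I T U) \<subseteq>
    lin_span (\<Union>i\<in>support. factor_space d n (fun_vs.span {T}) i)"
proof -
  obtain q where "tangent_direction I T U r q"
    by (rule tangent_direction[OF assms])
  then interpret dir: tangent_direction I T U r q .
  let ?G = "\<Union> (\<Union>i\<in>support. factor_space d n (fun_vs.span {T}) i)"
  have G: "pure_tensor d n (v(i := y)) \<in> ?G" if "i \<in> support" "y \<in> coord_space {0..n i}" for i y
    using Union_factor_space[of i] that support_subset by blast
  have "\<Union> (factor_space d n (fun_vs.span {T}) i) \<subseteq> coord_space I" if "i \<in> support" for i
  proof -
    have "i \<in> {1..d}" using that support_subset by blast
    then show ?thesis
      using pure_tensor_coord_space by (auto simp: Union_factor_space simp del: Union_iff)
  qed
  then have "?G \<subseteq> coord_space I" by blast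
  then have "fun_vs.span ?G \<subseteq> coord_space I"
    by (intro fun_vs.span_minimal subspace_coord_space)
  moreover have "T \<in> fun_vs.span ?G"
  proof -
    obtain i where i: "i \<in> support" using assms by blast
    then have "pure_tensor d n (v(i := v i)) \<in> ?G"
      using v support_subset by (intro G) auto
    then show ?thesis by (simp add: fun_vs.span_base)
  qed
  moreover have "U \<in> fun_vs.span ?G"
    unfolding U_support using W support_subset
    by (intro fun_vs.span_sum fun_vs.span_base G) auto
  ultimately show ?thesis
    unfolding lin_span_def by (intro dir.scheme_span_subset fun_vs.subspace_span)
qed

end

context segre_point
begin

text \<open>Linearising at \<open>T\<close> the quadrics that exchange one index of \<open>a\<close>
  with that of \<open>r\<close> expresses \<open>w a\<close> through coordinates with fewer
  departures from \<open>r\<close>. Hence \<open>w\<close> is determined by its coordinates at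
  indices differing from \<open>r\<close> in at most one slot.\<close>

lemma tangent_vector_decomposition:
  assumes w: "w \<in> coord_space I"
    and tangent: "\<And>p. p \<in> vanishing_ideal I X \<Longrightarrow>
      (\<Sum>a\<in>I. mpoly_eval T (mpoly_partial a p) * w a) = 0"
  obtains W where "segre_tangent d n v r W"
    "w = fun_scale (w r) T + (\<Sum>i\<in>{1..d}. pure_tensor d n (v(i := W i)))"
proof -
  \<comment> \<open>\<open>W i\<close> collects the coordinates of \<open>w\<close> where only slot
    i departs from \<open>r\<close>, corrected by a multiple of \<open>v i\<close> so that the entry
    at \<open>r i\<close> is 0.\<close>
  define W where "W = (\<lambda>i b. if b \<le> n i then w (r(i := b)) - w r * v i b else 0)"
  \<comment> \<open>Resetting slot k to \<open>r k\<close> splits off the factor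
    \<open>x k (a k)\<close>.\<close>
  have split: "x k (a k) * pure_tensor d n x (a(k := r k)) = pure_tensor d n x a"
    if "a \<in> I" "k \<in> {1..d}" "x k (r k) = 1" for a k x
    using that pure_tensor_remove[OF multi_idx_update[OF that(1,2) r_le] that(2), of x]
      pure_tensor_remove[OF that(1,2), of x] by simp
  have step: "w a = T (a(i := r i)) * W i (a i) + v i (a i) * w (a(i := r i))"
    if a: "a \<in> I" and i: "i \<in> {1..d}" for a i
  proof -
    let ?b = "r(i := a i)" and ?c = "a(i := r i)"
    have mem: "?b \<in> I" "?c \<in> I"
      using a i r r_le multi_idx_le by (auto intro!: multi_idx_update)
    \<comment> \<open>This quadric vanishes on pure tensors, since exchanging the i-th indices of
      \<open>a\<close> and \<open>r\<close> preserves the product of the two coordinates.\<close>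
    define g :: "(nat \<Rightarrow> nat, 'a) mpoly" where "g = mvar a * mvar r - mvar ?b * mvar ?c"
    have "pure_tensor d n x a * pure_tensor d n x r =
        pure_tensor d n x ?b * pure_tensor d n x ?c" for x :: "nat \<Rightarrow> nat \<Rightarrow> 'a"
      using a i r mem by (simp add: pure_tensor_remove[of _ d n i])
    then have "mpoly_eval (fun_scale c (pure_tensor d n x)) g = 0"
      for c and x :: "nat \<Rightarrow> nat \<Rightarrow> 'a"
      by (simp add: g_def mpoly_eval_diff mpoly_eval_mult fun_scale_def mult.assoc mult.left_commute
          del: One_nat_def)
    then have "mpoly_eval y g = 0" if "P \<in> X" "y \<in> P" for P y
      using that unfolding segre_variety_iff by (auto simp: mem_span_singleton)
    moreover have "g \<in> polys I"
      unfolding g_def by (intro polys_diff polys_mult mvar_polys a r mem)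
    ultimately have "g \<in> vanishing_ideal I X"
      by (simp add: vanishing_ideal_def)
    then have "(\<Sum>a\<in>I. mpoly_eval T (mpoly_partial a g) * w a) = 0"
      by (rule tangent)
    also have "(\<Sum>a\<in>I. mpoly_eval T (mpoly_partial a g) * w a) =
        (T r * w a + T a * w r) - (T ?c * w ?b + T ?b * w ?c)"
      unfolding g_def mpoly_partial_diff mpoly_eval_diff left_diff_distrib sum_subtractf
      using a r mem by (simp only: derivative_mvar_mult[OF finite_multi_idx])
    finally have "w a = T ?c * w ?b + T ?b * w ?c - T a * w r"
      by (simp add: T_r algebra_simps)
    moreover have "T ?b = v i (a i)"
      using pure_tensor_at_r_update[OF i multi_idx_le[OF a i], of v] by (simp add: v_r)
    moreover have "T a = v i (a i) * T ?c"
      using split[OF a i, of v] v_r i by simp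
    ultimately show ?thesis
      using multi_idx_le[OF a i] by (simp add: W_def algebra_simps)
  qed
  \<comment> \<open>Induction on the set \<open>F\<close> of slots where \<open>a\<close> may differ
    from \<open>r\<close>; \<open>step\<close> resets one slot at a time.\<close>
  have decomp: "w a = w r * T a + (\<Sum>i\<in>F. pure_tensor d n (v(i := W i)) a)"
    if "finite F" "F \<subseteq> {1..d}" "a \<in> I" "\<forall>i\<in>{1..d} - F. a i = r i" for F a
    using that
  proof (induction F arbitrary: a)
    case empty
    then have "a = r"
      using r unfolding multi_idx_def by (intro PiE_ext) auto
    then show ?case by (simp add: T_r)
  next
    case (insert k F)
    have k: "k \<in> {1..d}" using insert.prems by simp
    let ?c = "a(k := r k)"
    have c: "?c \<in> I" using insert.prems k r_le by (intro multi_idx_update) auto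
    have IH: "w ?c = w r * T ?c + (\<Sum>i\<in>F. pure_tensor d n (v(i := W i)) ?c)"
      using insert.prems by (intro insert.IH[OF _ c]) auto
    have Tc: "v k (a k) * T ?c = T a"
      using split[OF insert.prems(2) k, of v] v_r k by simp
    have "v k (a k) * pure_tensor d n (v(i := W i)) ?c = pure_tensor d n (v(i := W i)) a"
      if "i \<in> F" for i
    proof -
      have "k \<noteq> i" using that insert.hyps(2) by auto
      then show ?thesis
        using split[OF insert.prems(2) k, of "v(i := W i)"] v_r[OF k] by simp
    qed
    then have sum: "v k (a k) * (\<Sum>i\<in>F. pure_tensor d n (v(i := W i)) ?c) =
        (\<Sum>i\<in>F. pure_tensor d n (v(i := W i)) a)"
      by (simp add: sum_distrib_left)
    have "pure_tensor d n (v(k := W k)) a = W k (a k) * T ?c"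
      using pure_tensor_update[OF insert.prems(2) k, of v "W k"] pure_tensor_remove[OF c k, of v]
        v_r[OF k] by simp
    moreover have "v k (a k) * w ?c = w r * T a + (\<Sum>i\<in>F. pure_tensor d n (v(i := W i)) a)"
      unfolding IH distrib_left sum Tc[symmetric] by (simp add: mult_ac)
    ultimately show ?case
      using step[OF insert.prems(2) k] insert.hyps by (simp add: mult.commute del: fun_upd_apply)
  qed
  have "segre_tangent d n v r W"
  proof
    fix i assume i: "i \<in> {1..d}"
    show "W i \<in> coord_space {0..n i}" by (auto simp: coord_space_def W_def)
    show "W i (r i) = 0" using v_r[OF i] by (simp add: W_def)
  qed
  moreover have "w = fun_scale (w r) T + (\<Sum>i\<in>{1..d}. pure_tensor d n (v(i := W i)))"
  proof
    fix a
    show "w a = (fun_scale (w r) T + (\<Sum>i\<in>{1..d}. pure_tensor d n (v(i := W i)))) a"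
    proof (cases "a \<in> I")
      case True
      then show ?thesis
        using decomp[of "{1..d}" a] by (simp add: sum_fun_apply fun_scale_def)
    next
      case False
      then show ?thesis
        using w by (simp add: sum_fun_apply fun_scale_def coord_space_def pure_tensor_def)
    qed
  qed
  ultimately show thesis by (rule that)
qed

end

section \<open>The rank of a tangent vector\<close>

text \<open>
  The substitution method: the functional in the variables \<open>x\<^sub>k, y\<^sub>k\<close> is specialised so that it
  kills one of the summands on the left; on the right, one of the factors disappears and only the
  constant \<open>c\<close> changes.
\<close>

lemma card_le_of_tangent_form:
  fixes \<alpha> \<beta> :: "'s \<Rightarrow> 'e \<Rightarrow> 'a::field"
  assumes "finite E" "finite S"
    and "\<And>x y. (\<Sum>s\<in>S. \<gamma> s * (\<Prod>i\<in>E. x i * \<alpha> s i + y i * \<beta> s i)) =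
      (\<Sum>i\<in>E. y i * (\<Prod>j\<in>E - {i}. x j)) + c * (\<Prod>i\<in>E. x i)"
  shows "card E \<le> card S"
  using assms
proof (induction E arbitrary: S \<gamma> c)
  case (insert k E)
  have insert_Diff: "insert k E - {i} = insert k (E - {i})" if "i \<in> E" for i
    using that insert.hyps by auto
  have eq: "(\<Sum>s\<in>S. \<gamma> s * (a * \<alpha> s k + b * \<beta> s k) * (\<Prod>i\<in>E. x i * \<alpha> s i + y i * \<beta> s i)) =
      a * (\<Sum>i\<in>E. y i * (\<Prod>j\<in>E - {i}. x j)) + (b + c * a) * (\<Prod>i\<in>E. x i)" for x y a b
  proof -
    let ?x = "x(k := a)" and ?y = "y(k := b)"
    have upd: "prod ?x A = prod x A" if "k \<notin> A" for A
      using that by (intro prod.cong) auto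
    have lhs: "(\<Prod>i\<in>insert k E. ?x i * \<alpha> s i + ?y i * \<beta> s i) =
        (a * \<alpha> s k + b * \<beta> s k) * (\<Prod>i\<in>E. x i * \<alpha> s i + y i * \<beta> s i)" for s
    proof -
      have "(\<Prod>i\<in>E. ?x i * \<alpha> s i + ?y i * \<beta> s i) = (\<Prod>i\<in>E. x i * \<alpha> s i + y i * \<beta> s i)"
        using insert.hyps by (intro prod.cong) auto
      then show ?thesis using insert.hyps by simp
    qed
    have "(\<Sum>i\<in>E. ?y i * (\<Prod>j\<in>insert k E - {i}. ?x j)) = a * (\<Sum>i\<in>E. y i * (\<Prod>j\<in>E - {i}. x j))"
      unfolding sum_distrib_left
    proof (rule sum.cong)
      fix i assume i: "i \<in> E"
      have "k \<notin> E - {i}" using insert.hyps by simp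
      then show "?y i * (\<Prod>j\<in>insert k E - {i}. ?x j) = a * (y i * (\<Prod>j\<in>E - {i}. x j))"
        using insert.hyps i upd[of "E - {i}"] by (auto simp: insert_Diff)
    qed simp
    moreover have "(\<Prod>j\<in>insert k E - {k}. ?x j) = (\<Prod>j\<in>E. x j)"
      using insert.hyps upd[of E] by simp
    moreover have "(\<Prod>j\<in>insert k E. ?x j) = a * (\<Prod>j\<in>E. x j)"
      using insert.hyps upd[of E] by simp
    ultimately show ?thesis
      using insert.prems(2)[of ?x ?y] insert.hyps
      by (simp only: lhs sum.insert mult.assoc fun_upd_same) (simp add: algebra_simps)
  qed
  \<comment> \<open>Setting the pair of variables at \<open>k\<close> to 0, 1 leaves the product of
    the \<open>x i\<close> on the right. It is not identically zero, so some term on the left must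
    survive.\<close>
  have "\<exists>s\<in>S. \<beta> s k \<noteq> 0"
  proof (rule ccontr)
    assume "\<not> (\<exists>s\<in>S. \<beta> s k \<noteq> 0)"
    then show False using eq[of 0 1 "\<lambda>_. 1" "\<lambda>_. 0"] by simp
  qed
  then obtain s where s: "s \<in> S" "\<beta> s k \<noteq> 0" by blast
  \<comment> \<open>With the pair at \<open>k\<close> set to 1, \<open>b\<close>, the term for
    \<open>s\<close> vanishes and \<open>c\<close> becomes \<open>b + c\<close>.\<close>
  define b where "b = - \<alpha> s k / \<beta> s k"
  have zero: "1 * \<alpha> s k + b * \<beta> s k = 0" using s(2) by (simp add: b_def)
  have "card E \<le> card (S - {s})"
  proof (rule insert.IH)
    fix x y
    show "(\<Sum>t\<in>S - {s}. \<gamma> t * (1 * \<alpha> t k + b * \<beta> t k) * (\<Prod>i\<in>E. x i * \<alpha> t i + y i * \<beta> t i)) =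
        (\<Sum>i\<in>E. y i * (\<Prod>j\<in>E - {i}. x j)) + (b + c) * (\<Prod>i\<in>E. x i)"
      using eq[of 1 b x y] s(1) zero insert.prems(1) by (simp add: sum.remove)
  qed (use insert.prems in simp)
  moreover have "card S = Suc (card (S - {s}))"
    using insert.prems(1) s(1) by (rule card.remove)
  ultimately show ?case using insert.hyps by simp
qed simp

section \<open>Contraction with product functionals\<close>

definition contraction :: "nat \<Rightarrow> (nat \<Rightarrow> nat) \<Rightarrow> (nat \<Rightarrow> nat \<Rightarrow> 'a) \<Rightarrow> ((nat \<Rightarrow> nat) \<Rightarrow> 'a::field) \<Rightarrow> 'a"
  where "contraction d n L t = (\<Sum>a\<in>multi_idx d n. (\<Prod>i\<in>{1..d}. L i (a i)) * t a)"

lemma contraction_add: "contraction d n L (s + t) = contraction d n L s + contraction d n L t"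
  by (simp add: contraction_def distrib_left sum.distrib)

lemma contraction_scale: "contraction d n L (fun_scale c t) = c * contraction d n L t"
  by (simp add: contraction_def fun_scale_def sum_distrib_left mult_ac)

lemma contraction_sum: "contraction d n L (sum f A) = (\<Sum>a\<in>A. contraction d n L (f a))"
  unfolding contraction_def sum_fun_apply sum_distrib_left by (rule sum.swap)

lemma contraction_pure_tensor:
  "contraction d n L (pure_tensor d n x) = (\<Prod>i\<in>{1..d}. \<Sum>b\<in>{0..n i}. L i b * x i b)"
proof -
  have "(\<Prod>i\<in>{1..d}. \<Sum>b\<in>{0..n i}. L i b * x i b) =
      (\<Sum>a\<in>multi_idx d n. \<Prod>i\<in>{1..d}. L i (a i) * x i (a i))"
    unfolding multi_idx_def by (rule prod_sum_PiE) auto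
  then show ?thesis
    by (simp add: contraction_def pure_tensor_def prod.distrib)
qed

context segre_tangent
begin

text \<open>Contraction reduces the claim to the substitution method: slots outside the support are
  evaluated at \<open>r i\<close>, the others by functionals depending linearly on
  \<open>x i\<close>, \<open>y i\<close>. \<open>T\<close> becomes the product of the
  \<open>x i\<close>, and \<open>U\<close> the sum of the products with one \<open>x i\<close>
  replaced by \<open>y i\<close>.\<close>

lemma card_support_le:
  assumes B: "finite B" and eq: "fun_scale c T + U = (\<Sum>s\<in>B. fun_scale (\<gamma> s) (pure_tensor d n (z s)))"
  shows "card support \<le> card B"
proof -
  have "\<forall>i\<in>support. \<exists>b. W i b \<noteq> 0"
    by (auto simp: support_def)
  then obtain q where q: "\<And>i. i \<in> support \<Longrightarrow> W i (q i) \<noteq> 0" by metis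
  have q_le: "q i \<le> n i" if "i \<in> support" for i
    using q[OF that] W[of i] that support_subset by (force simp: coord_space_def)
  \<comment> \<open>Evaluation at \<open>r i\<close> and \<open>g i\<close> are dual to
    \<open>v i\<close> and \<open>W i\<close>: on these, the first takes the values 1, 0 and the
    second 0, 1.\<close>
  define g where "g = (\<lambda>i y. (y (q i) - v i (q i) * y (r i)) / W i (q i))"
  define \<beta> where "\<beta> = (\<lambda>s i. g i (z s i))"
  define \<alpha> where "\<alpha> = (\<lambda>s i. z s i (r i))"
  define \<delta> where "\<delta> = (\<lambda>s. \<gamma> s * (\<Prod>i\<in>{1..d} - support. z s i (r i)))"
  have "finite support" using support_subset finite_subset by blast
  then show ?thesis
  proof (rule card_le_of_tangent_form[OF _ B])
    fix x y :: "nat \<Rightarrow> 'a"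
    \<comment> \<open>On the support, the coefficients of \<open>x i\<close> times evaluation at
      \<open>r i\<close> plus \<open>y i\<close> times \<open>g i\<close>.\<close>
    define L where "L = (\<lambda>i b. if i \<in> support
      then (if b = r i then x i - y i * v i (q i) / W i (q i) else 0) +
        (if b = q i then y i / W i (q i) else 0)
      else if b = r i then 1 else 0)"
    have L: "(\<Sum>b\<in>{0..n i}. L i b * u b) = (if i \<in> support then x i * u (r i) + y i * g i u else u (r i))"
      if "i \<in> {1..d}" for i u
    proof (cases "i \<in> support")
      case True
      have "(\<Sum>b\<in>{0..n i}. L i b * u b) =
          (\<Sum>b\<in>{0..n i}. if b = r i then (x i - y i * v i (q i) / W i (q i)) * u b else 0) +
          (\<Sum>b\<in>{0..n i}. if b = q i then y i / W i (q i) * u b else 0)"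
        unfolding sum.distrib[symmetric] using True
        by (intro sum.cong) (auto simp: L_def distrib_right)
      then show ?thesis
        using True r_le[OF that] q_le[OF True] by (simp add: g_def diff_divide_distrib algebra_simps)
    next
      case False
      have "(\<Sum>b\<in>{0..n i}. L i b * u b) = (\<Sum>b\<in>{0..n i}. if b = r i then u b else 0)"
        using False by (intro sum.cong) (auto simp: L_def)
      then show ?thesis using False r_le[OF that] by simp
    qed
    have prod: "contraction d n L (pure_tensor d n u) =
        (\<Prod>i\<in>{1..d} - support. u i (r i)) * (\<Prod>i\<in>support. x i * u i (r i) + y i * g i (u i))" for u
    proof -
      have "contraction d n L (pure_tensor d n u) =
          (\<Prod>i\<in>{1..d}. if i \<in> support then x i * u i (r i) + y i * g i (u i) else u i (r i))"
        unfolding contraction_pure_tensor using L by (intro prod.cong) auto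
      also have "\<dots> = (\<Prod>i\<in>{1..d} - support. if i \<in> support then x i * u i (r i) + y i * g i (u i) else u i (r i)) *
          (\<Prod>i\<in>support. if i \<in> support then x i * u i (r i) + y i * g i (u i) else u i (r i))"
        using support_subset by (intro prod.subset_diff) auto
      finally show ?thesis by simp
    qed
    have v_eval: "x i * v i (r i) + y i * g i (v i) = x i" if "i \<in> support" for i
      using v_r[of i] that support_subset by (auto simp: g_def)
    have W_eval: "x i * W i (r i) + y i * g i (W i) = y i" if "i \<in> support" for i
      using W_r[of i] q[OF that] that support_subset by (auto simp: g_def)
    have T_eval: "contraction d n L T = (\<Prod>i\<in>support. x i)"
      unfolding prod using v_eval v_r by simp
    have U_eval: "contraction d n L (pure_tensor d n (v(i := W i))) = y i * (\<Prod>j\<in>support - {i}. x j)"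
      if i: "i \<in> support" for i
    proof -
      have "(\<Prod>j\<in>{1..d} - support. (v(i := W i)) j (r j)) = 1"
        using i v_r by (intro prod.neutral) auto
      moreover have "(\<Prod>j\<in>support. x j * (v(i := W i)) j (r j) + y j * g j ((v(i := W i)) j)) =
          y i * (\<Prod>j\<in>support - {i}. x j * (v(i := W i)) j (r j) + y j * g j ((v(i := W i)) j))"
        using W_eval[OF i] by (simp add: prod.remove[OF \<open>finite support\<close> i])
      moreover have "(\<Prod>j\<in>support - {i}. x j * (v(i := W i)) j (r j) + y j * g j ((v(i := W i)) j)) =
          (\<Prod>j\<in>support - {i}. x j)"
        using v_eval by (intro prod.cong) auto
      ultimately show ?thesis unfolding prod by simp
    qed
    have "(\<Sum>s\<in>B. \<delta> s * (\<Prod>i\<in>support. x i * \<alpha> s i + y i * \<beta> s i)) =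
        (\<Sum>s\<in>B. contraction d n L (fun_scale (\<gamma> s) (pure_tensor d n (z s))))"
      unfolding contraction_scale prod \<delta>_def \<alpha>_def \<beta>_def by (simp add: mult.assoc)
    also have "\<dots> = contraction d n L (fun_scale c T + U)"
      unfolding eq contraction_sum ..
    also have "\<dots> = (\<Sum>i\<in>support. y i * (\<Prod>j\<in>support - {i}. x j)) + c * (\<Prod>i\<in>support. x i)"
      unfolding U_support contraction_add contraction_scale contraction_sum T_eval
      by (simp add: U_eval)
    finally show "(\<Sum>s\<in>B. \<delta> s * (\<Prod>i\<in>support. x i * \<alpha> s i + y i * \<beta> s i)) =
        (\<Sum>i\<in>support. y i * (\<Prod>j\<in>support - {i}. x j)) + c * (\<Prod>i\<in>support. x i)" .
  qed
qed

text \<open>Choosing one pure tensor on each point of \<open>S\<close> turns membership in the span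
  into a sum with one term per point.\<close>

lemma card_support_le_card:
  assumes S: "finite S" "S \<subseteq> X" and mem: "fun_scale c T + U \<in> fun_vs.span (\<Union>S)"
  shows "card support \<le> card S"
proof -
  have "\<exists>z. P = fun_vs.span {pure_tensor d n z}" if "P \<in> S" for P
    using subsetD[OF S(2) that] unfolding segre_variety_iff by blast
  then obtain z where z: "\<And>P. P \<in> S \<Longrightarrow> P = fun_vs.span {pure_tensor d n (z P)}" by metis
  have "P \<subseteq> fun_vs.span ((\<lambda>P. pure_tensor d n (z P)) ` S)" if "P \<in> S" for P
    by (subst z[OF that]) (use that in \<open>auto intro!: fun_vs.span_mono\<close>)
  then have "fun_vs.span (\<Union>S) \<subseteq> fun_vs.span ((\<lambda>P. pure_tensor d n (z P)) ` S)"
    by (intro fun_vs.span_minimal fun_vs.subspace_span) blast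
  then obtain \<gamma> where \<gamma>: "fun_scale c T + U =
      (\<Sum>t\<in>(\<lambda>P. pure_tensor d n (z P)) ` S. fun_scale (\<gamma> t) t)"
    using mem S(1) by (auto simp: fun_vs.span_finite)
  \<comment> \<open>Distinct points have distinct representatives, so the sum can be indexed by
    \<open>S\<close>.\<close>
  have inj: "inj_on (\<lambda>P. pure_tensor d n (z P)) S"
  proof (rule inj_onI)
    fix P Q assume PQ: "P \<in> S" "Q \<in> S" and eq: "pure_tensor d n (z P) = pure_tensor d n (z Q)"
    have "P = fun_vs.span {pure_tensor d n (z Q)}"
      unfolding eq[symmetric] by (rule z[OF PQ(1)])
    also have "\<dots> = Q" by (rule z[OF PQ(2), symmetric])
    finally show "P = Q" .
  qed
  show ?thesis
    using S(1) \<gamma> unfolding sum.reindex[OF inj] comp_def by (rule card_support_le)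
qed

end

text \<open>A point spans itself, while the empty set spans no point; this matches the type 1
  assigned on the variety.\<close>

lemma rank_segre_point:
  fixes P :: "((nat \<Rightarrow> nat) \<Rightarrow> 'a::field_char_0) set"
  assumes "P \<in> segre_variety d n"
  shows "rank_wrt (segre_variety d n) P = 1"
  unfolding rank_wrt_def
proof (rule Least_equality)
  obtain x where x: "P = fun_vs.span {x}" "x \<noteq> 0"
  proof -
    obtain v r where "segre_point d n v r" "P = fun_vs.span {pure_tensor d n v}"
      by (rule segre_variety_obtain[OF assms])
    then show thesis
      using that segre_point.T_r by fastforce
  qed
  then have "P \<in> lin_span {P}"
    by (auto simp: lin_span_def proj_def intro!: exI[of _ x] fun_vs.span_base)
  then show "\<exists>S. finite S \<and> S \<subseteq> segre_variety d n \<and> card S = 1 \<and> P \<in> lin_span S"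
    using assms by (intro exI[of _ "{P}"]) auto
next
  fix k assume "\<exists>S. finite S \<and> S \<subseteq> segre_variety d n \<and> card S = k \<and> P \<in> lin_span S"
  then obtain S where "finite S" "card S = k" "P \<in> lin_span S" by blast
  moreover have "lin_span {} = {}" by (simp add: lin_span_def proj_def)
  ultimately show "1 \<le> k" by (cases "k = 0") auto
qed

theorem theorem1:
  fixes d :: nat and n :: "nat \<Rightarrow> nat"
    and P :: "((nat \<Rightarrow> nat) \<Rightarrow> 'a::{alg_closed_field, field_char_0}) set"
  assumes "d \<ge> 1" and "\<forall>i\<in>{1..d}. n i \<ge> 1"
    and "P \<in> segre_tangent_developable d n"
  shows "rank_wrt (segre_variety d n) P = tensor_type d n P"
proof (cases "P \<in> segre_variety d n")
  case True
  then show ?thesis by (simp add: rank_segre_point tensor_type_def)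
next
  case False
  let ?X = "segre_variety d n :: ((nat \<Rightarrow> nat) \<Rightarrow> 'a) set set"
  let ?I = "multi_idx d n"
  define is_type where "is_type = (\<lambda>k. \<exists>R Z E. (R, Z) \<in> tangent_vectors d n \<and> E \<subseteq> {1..d} \<and>
    card E = k \<and> P \<in> scheme_span ?I Z \<and>
    scheme_span ?I Z \<subseteq> lin_span (\<Union>i\<in>E. factor_space d n R i))"
  define is_rank where "is_rank = (\<lambda>k. \<exists>S. finite S \<and> S \<subseteq> ?X \<and> card S = k \<and> P \<in> lin_span S)"
  have type: "tensor_type d n P = Least is_type"
    using False by (simp add: tensor_type_def is_type_def)
  have rank: "rank_wrt ?X P = Least is_rank"
    by (simp add: rank_wrt_def is_rank_def)

  obtain Q where Q: "Q \<in> ?X" "P \<in> tangent_space ?I ?X Q"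
    using assms(3) by (auto simp: segre_tangent_developable_def tangent_developable_def)
  obtain v r where "segre_point d n v r" and Q_eq: "Q = fun_vs.span {pure_tensor d n v}"
    by (rule segre_variety_obtain[OF Q(1)])
  then interpret segre_point d n v r by simp
  have "T \<in> Q" "T \<noteq> 0"
    using T_r by (auto simp: Q_eq fun_vs.span_base)
  then obtain w where w: "P = fun_vs.span {w}" "w \<noteq> 0" "w \<in> coord_space ?I"
    "\<And>p. p \<in> vanishing_ideal ?I ?X \<Longrightarrow> (\<Sum>a\<in>?I. mpoly_eval T (mpoly_partial a p) * w a) = 0"
    using Q(2) unfolding tangent_space_def proj_def by blast
  obtain W where "segre_tangent d n v r W"
    and w_eq: "w = fun_scale (w r) T + (\<Sum>i\<in>{1..d}. pure_tensor d n (v(i := W i)))"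
    by (rule tangent_vector_decomposition[OF w(3,4)])
  then interpret segre_tangent d n v r W by simp
  have w_U: "w = fun_scale (w r) T + U"
    using w_eq by (simp add: U_def)
  \<comment> \<open>If every \<open>W i\<close> were 0, \<open>P\<close> would be the point of
    \<open>T\<close>, which lies on the variety.\<close>
  have support: "support \<noteq> {}"
  proof
    assume "support = {}"
    then have "w = fun_scale (w r) T" using w_U by (simp add: U_support)
    moreover from this have "w r \<noteq> 0" using w(2) by (auto simp: fun_scale_def)
    ultimately have "P = fun_vs.span {T}" using w(1) span_fun_scale by metis
    then show False using False span_T_mem_X by simp
  qed

  \<comment> \<open>Upper bound for the type: \<open>P\<close> lies in the span of the double point
    at \<open>T\<close> in direction \<open>U\<close>, with \<open>support\<close> as index
    set.\<close>
  have "is_type (card support)"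
  proof -
    obtain q where "tangent_direction ?I T U r q"
      by (rule tangent_direction[OF support])
    moreover have "w \<in> fun_vs.span {T, U}"
      by (subst w_U) (intro fun_vs.span_add fun_vs.span_scale fun_vs.span_base; simp)
    ultimately have "P \<in> scheme_span ?I (double_point ?I T U)"
      unfolding w(1) using w(2) by (intro tangent_direction.mem_scheme_span)
    then show ?thesis
      unfolding is_type_def
      using tangent_vector[OF support] scheme_span_factor_spaces[OF support] support_subset by blast
  qed
  then have type_le: "tensor_type d n P \<le> card support" and "is_type (tensor_type d n P)"
    unfolding type by (auto intro: Least_le LeastI)
  \<comment> \<open>The minimum is attained by data that may belong to another base point than
    \<open>Q\<close>; only the span of its factor spaces matters from here on.\<close>
  then obtain R Z E where E: "(R, Z) \<in> tangent_vectors d n" "E \<subseteq> {1..d}"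
    "card E = tensor_type d n P" "P \<in> lin_span (\<Union>i\<in>E. factor_space d n R i)"
    unfolding is_type_def by blast
  \<comment> \<open>A sum with one pure tensor per index of \<open>E\<close> bounds the rank by the
    type.\<close>
  obtain S where S: "finite S" "S \<subseteq> ?X" "card S \<le> tensor_type d n P" "P \<in> lin_span S"
  proof -
    have "R \<in> ?X" using E(1) by (simp add: tangent_vectors_def)
    then obtain v' r' where v': "segre_point d n v' r'" "R = fun_vs.span {pure_tensor d n v'}"
      by (rule segre_variety_obtain)
    interpret R: segre_point d n v' r' by (rule v'(1))
    obtain x where x: "P = fun_vs.span {x}" "x \<noteq> 0"
      "x \<in> fun_vs.span (\<Union> (\<Union>i\<in>E. factor_space d n (fun_vs.span {pure_tensor d n v'}) i))"
      using E(4) unfolding lin_span_def proj_def v'(2) by blast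
    obtain y where y: "\<And>i. i \<in> E \<Longrightarrow> y i \<in> coord_space {0..n i}"
      "x = (\<Sum>i\<in>E. pure_tensor d n (v'(i := y i)))"
      using R.span_factor_spaces[OF E(2) x(3)] by blast
    show thesis
      using R.sum_updates_mem_lin_span[OF E(2) y x(2)] that E(3) x(1) by metis
  qed
  then have is_rank: "is_rank (card S)" by (auto simp: is_rank_def)
  then have "rank_wrt ?X P \<le> card S" and "is_rank (rank_wrt ?X P)"
    unfolding rank by (auto intro: Least_le LeastI)
  \<comment> \<open>Lower bound for the rank: the substitution method applies to any decomposition
    of \<open>w\<close>, with \<open>w r\<close> as the coefficient of \<open>T\<close>.\<close>
  moreover have "card support \<le> k" if "is_rank k" for k
  proof -
    obtain S where S: "finite S" "S \<subseteq> ?X" "card S = k" "P \<in> lin_span S"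
      using \<open>is_rank k\<close> by (auto simp: is_rank_def)
    have "P \<subseteq> fun_vs.span (\<Union>S)"
      using S(4) by (auto simp: lin_span_def proj_def mem_span_singleton fun_vs.span_scale)
    then have "w \<in> fun_vs.span (\<Union>S)"
      using w(1) fun_vs.span_base[of w "{w}"] by blast
    then show ?thesis
      using card_support_le_card[OF S(1,2), of "w r"] w_U S(3) by simp
  qed
  \<comment> \<open>The cycle closes: card support \<le> rank \<le> card S \<le> type \<le> card
    support.\<close>
  ultimately show ?thesis using type_le S(3) by force
qed

end
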